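(* Let $\mathbb{H}$ be a (normalized) quantum channel entropy. Then for all systems $A,B$ and every $\mathcal{N}\in\mathrm{CPTP}(A\to B)$, $\mathbb{H}(B|A)_{\mathcal{N}}\ge H_{\min}(B|A)_{\mathcal{N}}$, where $H_{\min}(B|A)_{\mathcal{N}}:=\log|B|-\log\min\{t\ge0:\ t\mathcal{R}^{A\to B}-\mathcal{N}\text{ is completely positive}\}$ and $\mathcal{R}^{A\to B}(\rho)=\mathrm{Tr}[\rho]\mathbf{u}^B$.
   Context: Systems are finite-dimensional; $\mathbf{u}^B=I^B/|B|$; $\log$ base 2; states are identified with channels with trivial input. A superchannel from $\mathrm{CPTP}(A\to B)$ to $\mathrm{CPTP}(A'\to B)$ is $\Theta[\mathcal{N}]=\mathcal{E}^{RB\to B}\circ\mathcal{N}^{A\to B}\circ\mathcal{V}^{A'\to RA}$ with $\mathcal{V}$ an isometry channel and $\mathcal{E}$ a channel; it is mixing if in a realization with minimal $|R|$, $\mathcal{E}(\tau^R\otimes\mathbf{u}^B)=\mathbf{u}^B$ for every density matrix $\tau^R$. For same output, $\mathcal{N}\succ\mathcal{M}$ iff $\mathcal{M}=\Theta[\mathcal{N}]$ for a mixing $\Theta$; for $\mathcal{N}\in\mathrm{CPTP}(A\to B)$, $\mathcal{M}\in\mathrm{CPTP}(A'\to B')$: if $|B|>|B'|$, $\mathcal{N}\succ\mathcal{M}$ iff $\mathcal{N}\succ\mathcal{U}\circ\mathcal{M}$ for some isometry channel $\mathcal{U}:B'\to B$; if $|B|\le|B'|$, iff $\mathcal{W}\circ\mathcal{N}\succ\mathcal{M}$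 for some isometry channel $\mathcal{W}:B\to B'$. A (normalized) channel entropy is a function $\mathcal{N}^{A\to B}\mapsto\mathbb{H}(B|A)_{\mathcal{N}}\in\mathbb{R}$ on all channels between finite-dimensional systems, not identically zero, such that: (monotonicity) $\mathcal{N}^{A\to B}\succ\mathcal{M}^{A'\to B'}$ implies $\mathbb{H}(B|A)_{\mathcal{N}}\le\mathbb{H}(B'|A')_{\mathcal{M}}$; (additivity) $\mathbb{H}(BB'|AA')_{\mathcal{N}\otimes\mathcal{M}}=\mathbb{H}(B|A)_{\mathcal{N}}+\mathbb{H}(B'|A')_{\mathcal{M}}$; (normalization) the uniform qubit state has entropy $1$. *)

theory Defs
  imports "HOL-Analysis.Analysis" "Jordan_Normal_Form.Matrix"
begin

(* Operators on a d-dimensional system are d x d complex matrices (JNF 'complex mat').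
   A linear map from system A (dim dA) to system B (dim dB) is a function
   complex mat => complex mat, of which only its values on dA x dA matrices matter. *)

type_synonym cmat = "complex mat"
type_synonym chmap = "complex mat \<Rightarrow> complex mat"

definition adj :: "cmat \<Rightarrow> cmat" where
  "adj A = mat (dim_col A) (dim_row A) (\<lambda>(i,j). cnj (A $$ (j,i)))"

definition tr :: "cmat \<Rightarrow> complex" where
  "tr A = (\<Sum>i<dim_row A. A $$ (i,i))"

definition psd :: "nat \<Rightarrow> cmat \<Rightarrow> bool" where
  "psd n A \<longleftrightarrow> A \<in> carrier_mat n n \<and>
     (\<forall>v :: nat \<Rightarrow> complex.
        let q = (\<Sum>i<n. \<Sum>j<n. cnj (v i) * A $$ (i,j) * v j) in Im q = 0 \<and> Re q \<ge> 0)"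

definition density :: "nat \<Rightarrow> cmat \<Rightarrow> bool" where
  "density n \<rho> \<longleftrightarrow> psd n \<rho> \<and> tr \<rho> = 1"

definition munit :: "nat \<Rightarrow> nat \<Rightarrow> nat \<Rightarrow> cmat" where
  "munit n i j = mat n n (\<lambda>(k,l). if k = i \<and> l = j then 1 else 0)"

(* Kronecker product; index (a,b) of the composite is a * dim B + b *)
definition kron :: "cmat \<Rightarrow> cmat \<Rightarrow> cmat" where
  "kron A B = mat (dim_row A * dim_row B) (dim_col A * dim_col B)
     (\<lambda>(i,j). A $$ (i div dim_row B, j div dim_col B) * B $$ (i mod dim_row B, j mod dim_col B))"

definition umix :: "nat \<Rightarrow> cmat" where
  "umix n = (1 / of_nat n) \<cdot>\<^sub>m 1\<^sub>m n"

definition lin_map :: "nat \<Rightarrow> nat \<Rightarrow> chmap \<Rightarrow> bool" where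
  "lin_map dA dB \<Phi> \<longleftrightarrow>
     (\<forall>X \<in> carrier_mat dA dA. \<Phi> X \<in> carrier_mat dB dB) \<and>
     (\<forall>X \<in> carrier_mat dA dA. \<forall>Y \<in> carrier_mat dA dA. \<Phi> (X + Y) = \<Phi> X + \<Phi> Y) \<and>
     (\<forall>c. \<forall>X \<in> carrier_mat dA dA. \<Phi> (c \<cdot>\<^sub>m X) = c \<cdot>\<^sub>m \<Phi> X)"

(* tensor product of linear maps Phi : A -> B and Psi : A' -> B', acting on AA' -> BB'
   (the linear extension of X (x) Y |-> Phi X (x) Psi Y) *)
definition tensor_map :: "nat \<Rightarrow> nat \<Rightarrow> nat \<Rightarrow> nat \<Rightarrow> chmap \<Rightarrow> chmap \<Rightarrow> chmap" where
  "tensor_map dA dA' dB dB' \<Phi> \<Psi> X = mat (dB * dB') (dB * dB') (\<lambda>(r,s).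
      \<Sum>i<dA. \<Sum>j<dA. \<Sum>k<dA'. \<Sum>l<dA'.
         X $$ (i * dA' + k, j * dA' + l) *
         kron (\<Phi> (munit dA i j)) (\<Psi> (munit dA' k l)) $$ (r,s))"

definition CP :: "nat \<Rightarrow> nat \<Rightarrow> chmap \<Rightarrow> bool" where
  "CP dA dB \<Phi> \<longleftrightarrow> lin_map dA dB \<Phi> \<and>
     (\<forall>k \<ge> 1. \<forall>X. psd (k * dA) X \<longrightarrow> psd (k * dB) (tensor_map k dA k dB (\<lambda>Y. Y) \<Phi> X))"

definition TP :: "nat \<Rightarrow> chmap \<Rightarrow> bool" where
  "TP dA \<Phi> \<longleftrightarrow> (\<forall>X \<in> carrier_mat dA dA. tr (\<Phi> X) = tr X)"

definition is_channel :: "nat \<Rightarrow> nat \<Rightarrow> chmap \<Rightarrow> bool" where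
  "is_channel dA dB \<Phi> \<longleftrightarrow> dA \<ge> 1 \<and> dB \<ge> 1 \<and> CP dA dB \<Phi> \<and> TP dA \<Phi>"

definition ch_eq :: "nat \<Rightarrow> chmap \<Rightarrow> chmap \<Rightarrow> bool" where
  "ch_eq dA \<Phi> \<Psi> \<longleftrightarrow> (\<forall>X \<in> carrier_mat dA dA. \<Phi> X = \<Psi> X)"

definition isometry :: "nat \<Rightarrow> nat \<Rightarrow> cmat \<Rightarrow> bool" where
  "isometry dIn dOut V \<longleftrightarrow> V \<in> carrier_mat dOut dIn \<and> adj V * V = 1\<^sub>m dIn"

definition iso_ch :: "cmat \<Rightarrow> chmap" where
  "iso_ch V X = V * X * adj V"

(* realization (dR, V, E) of a superchannel CPTP(A->B) -> CPTP(A'->B):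
   V : A' -> RA isometry, E : RB -> B channel *)
definition super_real :: "nat \<Rightarrow> nat \<Rightarrow> nat \<Rightarrow> nat \<Rightarrow> cmat \<Rightarrow> chmap \<Rightarrow> bool" where
  "super_real dA dB dA' dR V E \<longleftrightarrow>
     dR \<ge> 1 \<and> isometry dA' (dR * dA) V \<and> is_channel (dR * dB) dB E"

definition super_apply :: "nat \<Rightarrow> nat \<Rightarrow> nat \<Rightarrow> cmat \<Rightarrow> chmap \<Rightarrow> chmap \<Rightarrow> chmap" where
  "super_apply dA dB dR V E \<Phi> = (\<lambda>X. E (tensor_map dR dA dR dB (\<lambda>Y. Y) \<Phi> (iso_ch V X)))"

definition same_super :: "nat \<Rightarrow> nat \<Rightarrow> nat \<Rightarrow> nat \<Rightarrow> cmat \<Rightarrow> chmap \<Rightarrow> nat \<Rightarrow> cmat \<Rightarrow> chmap \<Rightarrow> bool" where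
  "same_super dA dB dA' dR V E dR1 V1 E1 \<longleftrightarrow>
     (\<forall>\<Phi>. is_channel dA dB \<Phi> \<longrightarrow>
        ch_eq dA' (super_apply dA dB dR V E \<Phi>) (super_apply dA dB dR1 V1 E1 \<Phi>))"

definition mixing :: "nat \<Rightarrow> nat \<Rightarrow> nat \<Rightarrow> nat \<Rightarrow> cmat \<Rightarrow> chmap \<Rightarrow> bool" where
  "mixing dA dB dA' dR V E \<longleftrightarrow>
     (\<exists>dR0 V0 E0. super_real dA dB dA' dR0 V0 E0 \<and>
        same_super dA dB dA' dR0 V0 E0 dR V E \<and>
        (\<forall>dR1 V1 E1. super_real dA dB dA' dR1 V1 E1 \<and>
            same_super dA dB dA' dR1 V1 E1 dR V E \<longrightarrow> dR0 \<le> dR1) \<and>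
        (\<forall>\<tau>. density dR0 \<tau> \<longrightarrow> E0 (kron \<tau> (umix dB)) = umix dB))"

definition maj_same :: "nat \<Rightarrow> nat \<Rightarrow> chmap \<Rightarrow> nat \<Rightarrow> chmap \<Rightarrow> bool" where
  "maj_same dA dB \<Phi> dA' \<Psi> \<longleftrightarrow>
     (\<exists>dR V E. super_real dA dB dA' dR V E \<and> mixing dA dB dA' dR V E \<and>
        ch_eq dA' \<Psi> (super_apply dA dB dR V E \<Phi>))"

definition maj :: "nat \<Rightarrow> nat \<Rightarrow> chmap \<Rightarrow> nat \<Rightarrow> nat \<Rightarrow> chmap \<Rightarrow> bool" where
  "maj dA dB \<Phi> dA' dB' \<Psi> \<longleftrightarrow>
     (if dB > dB'
      then (\<exists>U. isometry dB' dB U \<and> maj_same dA dB \<Phi> dA' (iso_ch U \<circ> \<Psi>))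
      else (\<exists>W. isometry dB dB' W \<and> maj_same dA dB' (iso_ch W \<circ> \<Phi>) dA' \<Psi>))"

(* replacement channel R^{A->B}(rho) = Tr[rho] u^B; with dA = 1 it is the state u^B *)
definition repl :: "nat \<Rightarrow> chmap" where
  "repl dB X = tr X \<cdot>\<^sub>m umix dB"

definition channel_entropy :: "(nat \<Rightarrow> nat \<Rightarrow> chmap \<Rightarrow> real) \<Rightarrow> bool" where
  "channel_entropy H \<longleftrightarrow>
     (\<exists>dA dB \<Phi>. is_channel dA dB \<Phi> \<and> H dA dB \<Phi> \<noteq> 0) \<and>
     (\<forall>dA dB \<Phi> dA' dB' \<Psi>. is_channel dA dB \<Phi> \<longrightarrow> is_channel dA' dB' \<Psi> \<longrightarrow>
        maj dA dB \<Phi> dA' dB' \<Psi> \<longrightarrow> H dA dB \<Phi> \<le> H dA' dB' \<Psi>) \<and>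
     (\<forall>dA dB \<Phi> dA' dB' \<Psi>. is_channel dA dB \<Phi> \<longrightarrow> is_channel dA' dB' \<Psi> \<longrightarrow>
        H (dA * dA') (dB * dB') (tensor_map dA dA' dB dB' \<Phi> \<Psi>) = H dA dB \<Phi> + H dA' dB' \<Psi>) \<and>
     H 1 2 (repl 2) = 1"

definition Hmin :: "nat \<Rightarrow> nat \<Rightarrow> chmap \<Rightarrow> real" where
  "Hmin dA dB \<Phi> = log 2 (real dB) -
     log 2 (LEAST t :: real. t \<ge> 0 \<and> CP dA dB (\<lambda>X. t \<cdot>\<^sub>m repl dB X - \<Phi> X))"

end

(* If t R - N is completely positive and k / l < |B| / t, put D = |B| l. Then the uniform state
   of dimension k, embedded in dimension D, majorizes N (x) u_l: measure whether the embedded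
   state lies in its k-dimensional support; if so apply N (x) u_l to the input, and otherwise the
   channel that is complementary to it with respect to the completely randomizing channel. Such a
   map fixes u_D for every input, so it is mixing. Monotonicity and additivity give
   H(N) >= H(u_k) - H(u_l) = log (k / l), and k / l may be taken arbitrarily close to |B| / t. *)

theory Submission
  imports Defs "Jordan_Normal_Form.Determinant"
begin

subsection \<open>Sesquilinear forms and amplifications\<close>

text \<open>A uniform state has an integer dimension, so comparing N with u_k alone would reach only
  logarithms of integers. The ancilla u_l turns these into logarithms of ratios, and additivity
  removes it again. It costs nothing: the replacement channel onto B (x) C^l is the one onto B with
  u_l appended, so N (x) u_l is dominated with the same constant t. The complementary channel has to
  be completely positive and has to carry a positive weight D - k. These are the two conditions t <=
  D / k and k < D, and k / l < |B| / t gives both, because t >= 1 by comparison of traces. Mixing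
  refers to a realization that is minimal among all realizations. A source with trivial input makes
  that harmless, since the isometry then goes from A' into R and bounds |R| from below. Two facts
  stand outside the comparison. The minimum that defines H_min is attained, as the feasible t form a
  closed set that contains |B|^2. And H(u_l) = log l for every l is derived from l = 2, because a
  monotone function on the positive integers that turns products into sums is a multiple of the
  logarithm.\<close>

lemma sum_lessThan_mult:
  fixes f :: "nat \<Rightarrow> 'a::comm_monoid_add"
  shows "(\<Sum>r<k * n. f r) = (\<Sum>p<k. \<Sum>i<n. f (p * n + i))"
proof (induction k)
  case (Suc k)
  have "(\<Sum>r<Suc k * n. f r) = (\<Sum>r<k * n. f r) + (\<Sum>r=k*n..<k*n+n. f r)"
    by (metis add.commute le_add1 lessThan_atLeast0 mult_Suc sum.atLeastLessThan_concat zero_le)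
  also have "(\<Sum>r=k*n..<k*n+n. f r) = (\<Sum>i<n. f (k * n + i))"
    using sum.shift_bounds_nat_ivl[of f 0 "k*n" n] by (simp add: lessThan_atLeast0 add.commute)
  finally show ?case using Suc by simp
qed simp

lemma pair_index_less: "p < k \<Longrightarrow> i < n \<Longrightarrow> p * n + i < k * (n::nat)"
  by (metis add.commute less_le_trans mult.commute mult_Suc_right mult_le_mono2 nat_add_left_cancel_less Suc_leI)

lemma div_index_less: "r < k * n \<Longrightarrow> r div n < (k::nat)"
  by (simp add: less_mult_imp_div_less)

lemma mod_index_less: "r < k * n \<Longrightarrow> r mod n < (n::nat)"
  by (metis mod_less_divisor mult_0_right not_less_zero gr0I)

lemmas index_less = pair_index_less div_index_less mod_index_less

text \<open>Two vectors rather than one: the Cauchy-Schwarz estimate for positive matrices expands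
  values at differences of vectors and meets the mixed terms.\<close>

definition qf :: "nat \<Rightarrow> cmat \<Rightarrow> (nat \<Rightarrow> complex) \<Rightarrow> (nat \<Rightarrow> complex) \<Rightarrow> complex" where
  "qf n A v w = (\<Sum>i<n. \<Sum>j<n. cnj (v i) * A $$ (i,j) * w j)"

lemma psd_iff_qf: "psd n A \<longleftrightarrow> A \<in> carrier_mat n n \<and> (\<forall>v. qf n A v v \<in> \<real>\<^sub>\<ge>\<^sub>0)"
  by (auto simp: psd_def qf_def complex_nonneg_Reals_iff Let_def)

lemma psd_carrier: "psd n A \<Longrightarrow> A \<in> carrier_mat n n"
  by (simp add: psd_def)

lemma psdD: "psd n A \<Longrightarrow> qf n A v v \<in> \<real>\<^sub>\<ge>\<^sub>0"
  by (simp add: psd_iff_qf)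

lemma sum_nonneg_Reals: "(\<And>i. i \<in> S \<Longrightarrow> f i \<in> \<real>\<^sub>\<ge>\<^sub>0) \<Longrightarrow> sum f S \<in> (\<real>\<^sub>\<ge>\<^sub>0 :: complex set)"
  by (induction S rule: infinite_finite_induct) auto

lemma qf_pair:
  "qf (k * n) A v w = (\<Sum>p<k. \<Sum>i<n. \<Sum>q<k. \<Sum>j<n. cnj (v (p*n+i)) * A $$ (p*n+i, q*n+j) * w (q*n+j))"
  by (simp add: qf_def sum_lessThan_mult)

definition blk :: "nat \<Rightarrow> nat \<Rightarrow> nat \<Rightarrow> cmat \<Rightarrow> cmat" where
  "blk d p q X = mat d d (\<lambda>(i,j). X $$ (p * d + i, q * d + j))"

text \<open>This is id_k (x) Phi in block form. \<open>tensor_map\<close> expands its arguments in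
  matrix units, whereas here Phi is evaluated at whole blocks, which makes compositions and sums of
  maps easy to treat.\<close>

definition ampl :: "nat \<Rightarrow> nat \<Rightarrow> nat \<Rightarrow> chmap \<Rightarrow> cmat \<Rightarrow> cmat" where
  "ampl k m n \<Phi> X = mat (k * n) (k * n)
     (\<lambda>(r,s). \<Phi> (blk m (r div n) (s div n) X) $$ (r mod n, s mod n))"

lemma blk_carrier [simp]: "blk d p q X \<in> carrier_mat d d"
  by (simp add: blk_def)

lemma lin_mapD:
  assumes "lin_map m n \<Phi>"
  shows "X \<in> carrier_mat m m \<Longrightarrow> \<Phi> X \<in> carrier_mat n n"
    and "X \<in> carrier_mat m m \<Longrightarrow> Y \<in> carrier_mat m m \<Longrightarrow> \<Phi> (X + Y) = \<Phi> X + \<Phi> Y"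
    and "X \<in> carrier_mat m m \<Longrightarrow> \<Phi> (c \<cdot>\<^sub>m X) = c \<cdot>\<^sub>m \<Phi> X"
  using assms unfolding lin_map_def by auto

lemma lin_map_zero:
  assumes l: "lin_map m n \<Phi>"
  shows "\<Phi> (0\<^sub>m m m) = 0\<^sub>m n n"
proof -
  have z: "(0\<^sub>m m m :: cmat) \<in> carrier_mat m m" by simp
  have "(0 :: complex) \<cdot>\<^sub>m 0\<^sub>m m m = 0\<^sub>m m m" by auto
  then have "\<Phi> (0\<^sub>m m m) = 0 \<cdot>\<^sub>m \<Phi> (0\<^sub>m m m)" using lin_mapD(3)[OF l z, of 0] by simp
  also have "\<dots> = 0\<^sub>m n n" using lin_mapD(1)[OF l z] by auto
  finally show ?thesis .
qed

text \<open>\<open>lin_map\<close> gives additivity for two summands, so the expansion in matrix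
  units is built by induction on a set S of positions, for the matrix that agrees with Y on S and
  vanishes elsewhere.\<close>

lemma lin_map_entries:
  assumes l: "lin_map m n \<Phi>" and Y: "Y \<in> carrier_mat m m" and x: "x < n" "y < n"
  shows "\<Phi> Y $$ (x,y) = (\<Sum>a<m. \<Sum>b<m. Y $$ (a,b) * \<Phi> (munit m a b) $$ (x,y))"
proof -
  have mu: "munit m a b \<in> carrier_mat m m" for a b by (simp add: munit_def)
  have "\<Phi> (mat m m (\<lambda>ij. if ij \<in> S then Y $$ ij else 0)) $$ (x,y)
        = (\<Sum>(a,b)\<in>S. Y $$ (a,b) * \<Phi> (munit m a b) $$ (x,y))"
    if "finite S" "S \<subseteq> {..<m} \<times> {..<m}" for S
    using that
  proof (induction S rule: finite_induct)
    case empty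
    have "mat m m (\<lambda>ij. if ij \<in> {} then Y $$ ij else 0) = 0\<^sub>m m m" by auto
    with lin_map_zero[OF l] x show ?case by simp
  next
    case (insert ab S)
    obtain a b where ab: "ab = (a,b)" by force
    let ?M = "mat m m (\<lambda>ij. if ij \<in> S then Y $$ ij else 0)"
    have M: "?M \<in> carrier_mat m m" by simp
    have e: "mat m m (\<lambda>ij. if ij \<in> insert ab S then Y $$ ij else 0)
       = Y $$ (a,b) \<cdot>\<^sub>m munit m a b + ?M"
      using insert ab by (intro eq_matI) (auto simp: munit_def)
    have "\<Phi> (mat m m (\<lambda>ij. if ij \<in> insert ab S then Y $$ ij else 0))
       = Y $$ (a,b) \<cdot>\<^sub>m \<Phi> (munit m a b) + \<Phi> ?M"
      unfolding e using lin_mapD[OF l] mu M by simp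
    then show ?case
      using insert ab x lin_mapD(1)[OF l mu, of a b] lin_mapD(1)[OF l M] by auto
  qed
  from this[of "{..<m} \<times> {..<m}"]
  have "\<Phi> (mat m m (\<lambda>ij. if ij \<in> {..<m} \<times> {..<m} then Y $$ ij else 0)) $$ (x,y)
    = (\<Sum>a<m. \<Sum>b<m. Y $$ (a,b) * \<Phi> (munit m a b) $$ (x,y))"
    by (simp add: sum.cartesian_product)
  moreover have "mat m m (\<lambda>ij. if ij \<in> {..<m} \<times> {..<m} then Y $$ ij else 0) = Y"
    using Y by auto
  ultimately show ?thesis by simp
qed

text \<open>The identity factor contributes a matrix unit, whose entry at the block position of
  (r,s) selects i = r div n and j = s div n. What remains is the matrix-unit expansion of Phi at
  that block.\<close>

lemma tensor_map_id_left:
  assumes l: "lin_map m n \<Phi>"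
  shows "tensor_map k m k n (\<lambda>Y. Y) \<Phi> X = ampl k m n \<Phi> X"
proof (intro eq_matI)
  fix r s assume "r < dim_row (ampl k m n \<Phi> X)" "s < dim_col (ampl k m n \<Phi> X)"
  then have r: "r < k * n" "s < k * n" by (auto simp: ampl_def)
  note rs = index_less(2,3)[OF r(1)] index_less(2,3)[OF r(2)]
  have mu: "munit m a b \<in> carrier_mat m m" for a b by (simp add: munit_def)
  have d: "dim_row (\<Phi> (munit m a b)) = n" "dim_col (\<Phi> (munit m a b)) = n" for a b
    using lin_mapD(1)[OF l mu, of a b] by auto
  let ?S = "\<lambda>i j. \<Sum>a<m. \<Sum>b<m. X $$ (i * m + a, j * m + b) * \<Phi> (munit m a b) $$ (r mod n, s mod n)"
  have "tensor_map k m k n (\<lambda>Y. Y) \<Phi> X $$ (r,s) =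
     (\<Sum>i<k. \<Sum>j<k. \<Sum>a<m. \<Sum>b<m. X $$ (i * m + a, j * m + b) *
       ((if r div n = i \<and> s div n = j then 1 else 0) * \<Phi> (munit m a b) $$ (r mod n, s mod n)))"
    using r rs d by (simp add: tensor_map_def kron_def) (simp add: munit_def)
  also have "\<dots> = (\<Sum>i<k. \<Sum>j<k. if r div n = i then if s div n = j then ?S i j else 0 else 0)"
  proof (intro sum.cong refl)
    fix i j
    show "(\<Sum>a<m. \<Sum>b<m. X $$ (i * m + a, j * m + b) *
       ((if r div n = i \<and> s div n = j then 1 else 0) * \<Phi> (munit m a b) $$ (r mod n, s mod n)))
     = (if r div n = i then if s div n = j then ?S i j else 0 else 0)"
      by (cases "r div n = i"; cases "s div n = j") simp_all
  qed
  also have "\<dots> = (\<Sum>i<k. if r div n = i then \<Sum>j<k. if s div n = j then ?S i j else 0 else 0)"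
  proof (intro sum.cong refl)
    fix i
    show "(\<Sum>j<k. if r div n = i then if s div n = j then ?S i j else 0 else 0)
      = (if r div n = i then \<Sum>j<k. if s div n = j then ?S i j else 0 else 0)"
      by (cases "r div n = i") (simp_all only: if_True if_False simp_thms sum.neutral_const)
  qed
  also have "\<dots> = (\<Sum>a<m. \<Sum>b<m. X $$ ((r div n) * m + a, (s div n) * m + b) *
       \<Phi> (munit m a b) $$ (r mod n, s mod n))"
    using rs by simp
  also have "\<dots> = (\<Sum>a<m. \<Sum>b<m. blk m (r div n) (s div n) X $$ (a,b) *
       \<Phi> (munit m a b) $$ (r mod n, s mod n))"
    by (intro sum.cong refl) (auto simp: blk_def)
  also have "\<dots> = \<Phi> (blk m (r div n) (s div n) X) $$ (r mod n, s mod n)"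
    using lin_map_entries[OF l blk_carrier rs(2,4)] by simp
  also have "\<dots> = ampl k m n \<Phi> X $$ (r,s)" using r by (simp add: ampl_def)
  finally show "tensor_map k m k n (\<lambda>Y. Y) \<Phi> X $$ (r,s) = ampl k m n \<Phi> X $$ (r,s)" .
qed (auto simp: ampl_def tensor_map_def)

lemma CP_iff_ampl:
  "CP m n \<Phi> \<longleftrightarrow> lin_map m n \<Phi> \<and>
     (\<forall>k\<ge>1. \<forall>X. psd (k * m) X \<longrightarrow> psd (k * n) (ampl k m n \<Phi> X))"
  by (auto simp: CP_def tensor_map_id_left)

lemma CP_lin_map: "CP m n \<Phi> \<Longrightarrow> lin_map m n \<Phi>"
  by (simp add: CP_def)

lemma ampl_carrier [simp]: "ampl k m n \<Phi> X \<in> carrier_mat (k * n) (k * n)"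
  by (simp add: ampl_def)

lemma CP_I:
  assumes "lin_map m n \<Phi>"
    and "\<And>k X v. k \<ge> 1 \<Longrightarrow> psd (k * m) X \<Longrightarrow> qf (k * n) (ampl k m n \<Phi> X) v v \<in> \<real>\<^sub>\<ge>\<^sub>0"
  shows "CP m n \<Phi>"
  using assms by (simp add: CP_iff_ampl psd_iff_qf)

lemma CP_D:
  assumes "CP m n \<Phi>" "k \<ge> 1" "psd (k * m) X"
  shows "qf (k * n) (ampl k m n \<Phi> X) v v \<in> \<real>\<^sub>\<ge>\<^sub>0"
  using assms by (simp add: CP_iff_ampl psd_iff_qf)

lemma qf_ampl:
  "qf (k * n) (ampl k m n \<Phi> X) v w
    = (\<Sum>r<k * n. \<Sum>s<k * n. cnj (v r) * \<Phi> (blk m (r div n) (s div n) X) $$ (r mod n, s mod n) * w s)"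
  by (simp add: qf_def ampl_def)

section \<open>Closure properties of complete positivity\<close>

lemma lin_map_cong:
  assumes "lin_map m n \<Phi>" "\<And>X. X \<in> carrier_mat m m \<Longrightarrow> \<Psi> X = \<Phi> X"
  shows "lin_map m n \<Psi>"
  using assms unfolding lin_map_def by simp

lemma CP_cong:
  assumes "CP m n \<Phi>" "\<And>X. X \<in> carrier_mat m m \<Longrightarrow> \<Psi> X = \<Phi> X"
  shows "CP m n \<Psi>"
proof -
  have "ampl k m n \<Psi> X = ampl k m n \<Phi> X" for k X
    by (simp add: ampl_def assms(2))
  with assms lin_map_cong[OF _ assms(2)] show ?thesis by (auto simp: CP_iff_ampl)
qed

text \<open>Amplification is functorial: the blocks of the amplified Phi are the images of the
  blocks of X, so amplifying the composite amounts to amplifying twice.\<close>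

lemma CP_comp:
  assumes "CP m n \<Phi>" "CP n r \<Psi>"
  shows "CP m r (\<lambda>X. \<Psi> (\<Phi> X))"
proof -
  have l: "lin_map m r (\<lambda>X. \<Psi> (\<Phi> X))"
    using CP_lin_map[OF assms(1)] CP_lin_map[OF assms(2)] unfolding lin_map_def by simp
  have "ampl k m r (\<lambda>X. \<Psi> (\<Phi> X)) X = ampl k n r \<Psi> (ampl k m n \<Phi> X)" for k X
  proof -
    have "blk n p q (ampl k m n \<Phi> X) = \<Phi> (blk m p q X)" if "p < k" "q < k" for p q
      using that lin_mapD(1)[OF CP_lin_map[OF assms(1)] blk_carrier, of p q X]
      by (intro eq_matI) (auto simp: blk_def ampl_def pair_index_less)
    then show ?thesis
      by (intro eq_matI) (auto simp: ampl_def[of k m r] ampl_def[of k n r] div_index_less)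
  qed
  with l assms show ?thesis by (simp add: CP_iff_ampl)
qed

lemma CP_smult:
  assumes "CP m n \<Phi>" "c \<ge> 0"
  shows "CP m n (\<lambda>X. of_real c \<cdot>\<^sub>m \<Phi> X)"
proof (rule CP_I)
  note L = lin_mapD[OF CP_lin_map[OF assms(1)]]
  show "lin_map m n (\<lambda>X. of_real c \<cdot>\<^sub>m \<Phi> X)"
    unfolding lin_map_def
  proof (intro conjI ballI allI)
    fix X Y :: cmat assume X: "X \<in> carrier_mat m m" and Y: "Y \<in> carrier_mat m m"
    show "of_real c \<cdot>\<^sub>m \<Phi> (X + Y) = of_real c \<cdot>\<^sub>m \<Phi> X + of_real c \<cdot>\<^sub>m \<Phi> Y"
      using L(1)[OF X] L(1)[OF Y] unfolding L(2)[OF X Y] by (auto simp: algebra_simps)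
  next
    fix d :: complex and X :: cmat assume X: "X \<in> carrier_mat m m"
    show "of_real c \<cdot>\<^sub>m \<Phi> (d \<cdot>\<^sub>m X) = d \<cdot>\<^sub>m (of_real c \<cdot>\<^sub>m \<Phi> X)"
      using L(1)[OF X] unfolding L(3)[OF X] by (auto simp: algebra_simps)
  qed (use L(1) in auto)
  fix k :: nat and X :: cmat and v :: "nat \<Rightarrow> complex" assume k: "k \<ge> (1::nat)" "psd (k * m) X"
  have "qf (k * n) (ampl k m n (\<lambda>X. of_real c \<cdot>\<^sub>m \<Phi> X) X) v v
      = of_real c * qf (k * n) (ampl k m n \<Phi> X) v v"
    unfolding qf_ampl sum_distrib_left
  proof (intro sum.cong refl)
    fix r s assume "r \<in> {..<k*n}" "s \<in> {..<k*n}"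
    then have "r mod n < n" "s mod n < n" by (auto intro: mod_index_less)
    then show "cnj (v r) * (of_real c \<cdot>\<^sub>m \<Phi> (blk m (r div n) (s div n) X)) $$ (r mod n, s mod n) * v s
      = of_real c * (cnj (v r) * \<Phi> (blk m (r div n) (s div n) X) $$ (r mod n, s mod n) * v s)"
      using L(1)[OF blk_carrier, of "r div n" "s div n" X] by simp
  qed
  then show "qf (k * n) (ampl k m n (\<lambda>X. of_real c \<cdot>\<^sub>m \<Phi> X) X) v v \<in> \<real>\<^sub>\<ge>\<^sub>0"
    using CP_D[OF assms(1) k] assms(2) by (simp add: nonneg_Reals_mult_I)
qed

text \<open>Summing entries inside \<open>mat n n\<close> fixes the size of the result even for N =
  0. The form of the amplified sum is the sum of the forms.\<close>

lemma CP_sum: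
  assumes "\<And>b. b < N \<Longrightarrow> CP m n (F b)"
  shows "CP m n (\<lambda>X. mat n n (\<lambda>xy. \<Sum>b<(N::nat). F b X $$ xy))"
proof (rule CP_I)
  note L = lin_mapD[OF CP_lin_map[OF assms]]
  have d: "dim_row (F b X) = n" "dim_col (F b X) = n" if "b < N" "X \<in> carrier_mat m m" for b X
    using L(1)[OF that] by auto
  show "lin_map m n (\<lambda>X. mat n n (\<lambda>xy. \<Sum>b<N. F b X $$ xy))"
    unfolding lin_map_def using d
    by (auto simp: L sum.distrib sum_distrib_left intro!: eq_matI)
  fix k :: nat and X :: cmat and v :: "nat \<Rightarrow> complex" assume k: "k \<ge> (1::nat)" "psd (k * m) X"
  have "qf (k * n) (ampl k m n (\<lambda>X. mat n n (\<lambda>xy. \<Sum>b<N. F b X $$ xy)) X) v v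
      = (\<Sum>r<k * n. \<Sum>s<k * n. \<Sum>b<N. cnj (v r) * F b (blk m (r div n) (s div n) X) $$ (r mod n, s mod n) * v s)"
    unfolding qf_ampl using mod_index_less
    by (intro sum.cong refl) (auto simp: sum_distrib_left sum_distrib_right)
  also have "\<dots> = (\<Sum>r<k * n. \<Sum>b<N. \<Sum>s<k * n. cnj (v r) * F b (blk m (r div n) (s div n) X) $$ (r mod n, s mod n) * v s)"
    by (intro sum.cong refl sum.swap)
  also have "\<dots> = (\<Sum>b<N. qf (k * n) (ampl k m n (F b) X) v v)"
    unfolding qf_ampl by (rule sum.swap)
  also have "\<dots> \<in> \<real>\<^sub>\<ge>\<^sub>0"
    using CP_D[OF assms k] by (intro sum_nonneg_Reals) auto
  finally show "qf (k * n) (ampl k m n (\<lambda>X. mat n n (\<lambda>xy. \<Sum>b<N. F b X $$ xy)) X) v v \<in> \<real>\<^sub>\<ge>\<^sub>0" .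
qed

lemma CP_add:
  assumes "CP m n \<Phi>" "CP m n \<Psi>"
  shows "CP m n (\<lambda>X. \<Phi> X + \<Psi> X)"
proof -
  have "CP m n (\<lambda>X. mat n n (\<lambda>xy. \<Sum>b<(2::nat). (if b = 0 then \<Phi> else \<Psi>) X $$ xy))"
    using assms by (intro CP_sum) auto
  then show ?thesis
  proof (rule CP_cong)
    fix X :: cmat assume X: "X \<in> carrier_mat m m"
    show "\<Phi> X + \<Psi> X = mat n n (\<lambda>xy. \<Sum>b<(2::nat). (if b = 0 then \<Phi> else \<Psi>) X $$ xy)"
      using lin_mapD(1)[OF CP_lin_map[OF assms(1)] X] lin_mapD(1)[OF CP_lin_map[OF assms(2)] X]
      by (intro eq_matI) (auto simp: numeral_2_eq_2)
  qed
qed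

section \<open>Compressions and appended uniform states\<close>

definition slice :: "nat \<Rightarrow> nat \<Rightarrow> nat \<Rightarrow> cmat \<Rightarrow> cmat" where
  "slice a d b X = mat a a (\<lambda>(i,j). X $$ (i * d + b, j * d + b))"

text \<open>\<open>slice\<close> is X |-> (I (x) <b|) X (I (x) |b>), a map with a single Kraus
  operator. Hence its amplified form at v is the form of X at v (x) |b>, the vector
  \<open>?w\<close> supported on the indices with residue b modulo d.\<close>

lemma CP_slice:
  assumes b: "b < d"
  shows "CP (a * d) a (slice a d b)"
proof (rule CP_I)
  show "lin_map (a * d) a (slice a d b)"
    unfolding lin_map_def slice_def using pair_index_less[OF _ b, of _ a]
    by (auto intro!: eq_matI)
  fix k :: nat and X :: cmat and v :: "nat \<Rightarrow> complex" assume k: "k \<ge> (1::nat)" "psd (k * (a * d)) X"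
  let ?w = "\<lambda>r. if r mod d = b then v (r div d) else 0"
  have "qf (k * a) (ampl k (a * d) a (slice a d b) X) v v =
     (\<Sum>r<k * a. \<Sum>s<k * a. cnj (v r) * X $$ (r * d + b, s * d + b) * v s)"
    unfolding qf_ampl
  proof (intro sum.cong refl)
    fix r s assume r: "r \<in> {..<k*a}" "s \<in> {..<k*a}"
    then have m: "r mod a < a" "s mod a < a" by (auto intro: mod_index_less)
    \<comment> \<open>Regroups C^k (x) (C^a (x) C^d) as (C^k (x) C^a) (x) C^d.\<close>
    have e: "r div a * (a * d) + (r mod a * d + b) = r * d + b" for r
      by (metis add.assoc add_mult_distrib div_mult_mod_eq mult.assoc)
    show "cnj (v r) * slice a d b (blk (a * d) (r div a) (s div a) X) $$ (r mod a, s mod a) * v s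
       = cnj (v r) * X $$ (r * d + b, s * d + b) * v s"
      using m pair_index_less[OF m(1) b] pair_index_less[OF m(2) b] by (simp add: slice_def blk_def e)
  qed
  also have "\<dots> = (\<Sum>r<k * a. \<Sum>c<d. \<Sum>s<k * a. \<Sum>e<d. cnj (?w (r * d + c)) * X $$ (r * d + c, s * d + e) * ?w (s * d + e))"
  proof (rule sum.cong[OF refl])
    fix r
    have "(\<Sum>c<d. \<Sum>s<k * a. \<Sum>e<d. cnj (?w (r * d + c)) * X $$ (r * d + c, s * d + e) * ?w (s * d + e))
       = (\<Sum>c<d. if c = b then \<Sum>s<k * a. \<Sum>e<d. if e = b then cnj (v r) * X $$ (r * d + c, s * d + e) * v s else 0 else 0)"
    proof (intro sum.cong refl)
      fix c assume c: "c \<in> {..<d}"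
      show "(\<Sum>s<k * a. \<Sum>e<d. cnj (?w (r * d + c)) * X $$ (r * d + c, s * d + e) * ?w (s * d + e))
        = (if c = b then \<Sum>s<k * a. \<Sum>e<d. if e = b then cnj (v r) * X $$ (r * d + c, s * d + e) * v s else 0 else 0)"
      proof (cases "c = b")
        case True
        have "(\<Sum>s<k * a. \<Sum>e<d. cnj (?w (r * d + c)) * X $$ (r * d + c, s * d + e) * ?w (s * d + e))
          = (\<Sum>s<k * a. \<Sum>e<d. if e = b then cnj (v r) * X $$ (r * d + c, s * d + e) * v s else 0)"
          using b True by (intro sum.cong refl) auto
        with True show ?thesis by simp
      qed (use c in simp)
    qed
    also have "\<dots> = (\<Sum>s<k * a. cnj (v r) * X $$ (r * d + b, s * d + b) * v s)"
      using b by simp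
    finally show "(\<Sum>s<k * a. cnj (v r) * X $$ (r * d + b, s * d + b) * v s) =
      (\<Sum>c<d. \<Sum>s<k * a. \<Sum>e<d. cnj (?w (r * d + c)) * X $$ (r * d + c, s * d + e) * ?w (s * d + e))" ..
  qed
  also have "\<dots> = qf (k * a * d) X ?w ?w" by (simp only: qf_pair)
  finally show "qf (k * a) (ampl k (a * d) a (slice a d b) X) v v \<in> \<real>\<^sub>\<ge>\<^sub>0"
    using psdD[OF k(2)] by (simp add: mult.assoc)
qed

text \<open>Since u_l is diagonal with entries 1 / l, the form of X (x) u_l at v is the average over
  c of the forms of X at the components of v with second index c.\<close>

lemma CP_kron_umix: "CP n (n * l) (\<lambda>X. kron X (umix l))"
proof (rule CP_I)
  have u: "dim_row (umix l) = l" "dim_col (umix l) = l" by (simp_all add: umix_def)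
  show "lin_map n (n * l) (\<lambda>X. kron X (umix l))"
    unfolding lin_map_def kron_def u using index_less(2)[of _ n l]
    by (auto intro!: eq_matI simp: algebra_simps)
  fix k :: nat and X :: cmat and v :: "nat \<Rightarrow> complex" assume k: "k \<ge> (1::nat)" "psd (k * n) X"
  have "qf (k * (n * l)) (ampl k n (n * l) (\<lambda>X. kron X (umix l)) X) v v =
     (\<Sum>r<k * n * l. \<Sum>s<k * n * l. cnj (v r) * (X $$ (r div l, s div l) * (if r mod l = s mod l then 1 / of_nat l else 0)) * v s)"
    unfolding qf_ampl mult.assoc[of k n l]
  proof (intro sum.cong refl)
    fix r s assume r: "r \<in> {..<k*(n*l)}" "s \<in> {..<k*(n*l)}"
    then have m: "r mod (n*l) < n*l" "s mod (n*l) < n*l" by (auto intro: mod_index_less)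
    have m2: "r mod l < l" "s mod l < l" using r by (auto simp flip: mult.assoc intro: mod_index_less)
    have m3: "(r mod (n*l)) div l < n" "(s mod (n*l)) div l < n" using m by (auto intro: div_index_less)
    \<comment> \<open>Again a regrouping of the triple index, so that the ancilla C^k joins the
      first factor and the last factor is read off modulo l.\<close>
    have e: "r div (n*l) * n + (r mod (n*l)) div l = r div l" "r mod (n*l) mod l = r mod l" for r
    proof -
      have l: "l > 0" using m2 by simp
      have "r mod (n*l) = l * (r div l mod n) + r mod l"
        by (metis mod_mult2_eq mult.commute)
      then show "r mod (n*l) mod l = r mod l" "r div (n*l) * n + (r mod (n*l)) div l = r div l"
        using l by (simp_all add: div_mult2_eq mult.commute[of n l])
    qed
    show "cnj (v r) * kron (blk n (r div (n*l)) (s div (n*l)) X) (umix l) $$ (r mod (n*l), s mod (n*l)) * v s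
       = cnj (v r) * (X $$ (r div l, s div l) * (if r mod l = s mod l then 1 / of_nat l else 0)) * v s"
      using m m2 m3 by (simp add: kron_def u blk_def e) (simp add: umix_def)
  qed
  also have "\<dots> = (\<Sum>i<k * n. \<Sum>c<l. \<Sum>j<k * n. cnj (v (i*l+c)) * X $$ (i, j) * (1 / of_nat l) * v (j*l+c))"
    unfolding sum_lessThan_mult[of _ "k*n" l]
    by (intro sum.cong refl) (auto simp: if_distrib if_distribR sum.delta sum.delta' mult.assoc cong: if_cong)
  also have "\<dots> = (\<Sum>c<l. (1 / of_nat l) * qf (k * n) X (\<lambda>i. v (i*l+c)) (\<lambda>i. v (i*l+c)))"
    unfolding qf_def sum_distrib_left
    by (subst sum.swap) (simp add: ac_simps)
  also have "\<dots> \<in> \<real>\<^sub>\<ge>\<^sub>0"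
  proof (intro sum_nonneg_Reals nonneg_Reals_mult_I psdD[OF k(2)])
    have "1 / of_nat l = complex_of_real (1 / real l)" by simp
    then show "1 / of_nat l \<in> (\<real>\<^sub>\<ge>\<^sub>0 :: complex set)"
      by (metis nonneg_Reals_of_real_iff of_nat_0_le_iff zero_le_divide_1_iff)
  qed
  finally show "qf (k * (n * l)) (ampl k n (n * l) (\<lambda>X. kron X (umix l)) X) v v \<in> \<real>\<^sub>\<ge>\<^sub>0" .
qed

subsection \<open>Domination by the replacement channel\<close>

lemma umix_carrier [simp]: "umix n \<in> carrier_mat n n"
  by (simp add: umix_def)

lemma repl_carrier [simp]: "repl n X \<in> carrier_mat n n"
  by (simp add: repl_def)

lemma dim_umix [simp]: "dim_row (umix n) = n" "dim_col (umix n) = n"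
  by (simp_all add: umix_def)

lemma dim_repl [simp]: "dim_row (repl n X) = n" "dim_col (repl n X) = n"
  by (simp_all add: repl_def)

lemma index_umix: "i < n \<Longrightarrow> j < n \<Longrightarrow> umix n $$ (i,j) = (if i = j then 1 / of_nat n else 0)"
  by (simp add: umix_def)

lemma index_repl: "i < n \<Longrightarrow> j < n \<Longrightarrow> repl n X $$ (i,j) = tr X * (if i = j then 1 / of_nat n else 0)"
  by (simp add: repl_def index_umix)

lemma tr_umix: "n \<ge> 1 \<Longrightarrow> tr (umix n) = 1"
  by (simp add: tr_def index_umix)

lemma tr_smult: "A \<in> carrier_mat n n \<Longrightarrow> tr (c \<cdot>\<^sub>m A) = c * tr A"
  by (auto simp: tr_def sum_distrib_left)

lemma tr_minus: "A \<in> carrier_mat n n \<Longrightarrow> B \<in> carrier_mat n n \<Longrightarrow> tr (A - B) = tr A - tr B"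
  by (auto simp: tr_def sum_subtractf)

lemma tr_repl: "n \<ge> 1 \<Longrightarrow> tr (repl n X) = tr X"
  by (simp add: repl_def tr_smult[OF umix_carrier] tr_umix)

text \<open>The trace is the sum of the compressions to the basis vectors, each a 1 x 1 matrix, and
  u_n is appended to each of them.\<close>

lemma CP_repl: "CP m n (repl n)"
proof -
  have c: "CP m n (\<lambda>X. kron (slice 1 m b X) (umix n))" if "b < m" for b
    using CP_comp[OF CP_slice[OF that, of 1] CP_kron_umix[of 1 n]] by simp
  show ?thesis
  proof (rule CP_cong[OF CP_sum[OF c]])
    fix X :: cmat assume X: "X \<in> carrier_mat m m"
    show "repl n X = mat n n (\<lambda>xy. \<Sum>b<m. kron (slice 1 m b X) (umix n) $$ xy)"
    proof (rule eq_matI)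
      fix x y
      assume "x < dim_row (mat n n (\<lambda>xy. \<Sum>b<m. kron (slice 1 m b X) (umix n) $$ xy))"
        "y < dim_col (mat n n (\<lambda>xy. \<Sum>b<m. kron (slice 1 m b X) (umix n) $$ xy))"
      then have xy: "x < n" "y < n" by auto
      then have "(\<Sum>b<m. kron (slice 1 m b X) (umix n) $$ (x,y)) = (\<Sum>b<m. X $$ (b,b) * umix n $$ (x,y))"
        by (intro sum.cong refl) (simp add: kron_def slice_def)
      then show "repl n X $$ (x,y) = mat n n (\<lambda>xy. \<Sum>b<m. kron (slice 1 m b X) (umix n) $$ xy) $$ (x,y)"
        using xy X by (simp add: index_repl index_umix tr_def sum_distrib_right)
    qed auto
  qed auto
qed

lemma lin_map_smult_diff:
  assumes "lin_map m n \<Phi>" "lin_map m n \<Psi>"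
  shows "lin_map m n (\<lambda>X. c \<cdot>\<^sub>m \<Phi> X - \<Psi> X)"
  unfolding lin_map_def
proof (intro conjI ballI allI)
  fix X Y :: cmat assume X: "X \<in> carrier_mat m m" and Y: "Y \<in> carrier_mat m m"
  note L = lin_mapD[OF assms(1)] lin_mapD[OF assms(2)]
  show "c \<cdot>\<^sub>m \<Phi> (X + Y) - \<Psi> (X + Y) = c \<cdot>\<^sub>m \<Phi> X - \<Psi> X + (c \<cdot>\<^sub>m \<Phi> Y - \<Psi> Y)"
    using L(1,4)[OF X] L(1,4)[OF Y] unfolding L(2,5)[OF X Y] by (auto simp: algebra_simps)
next
  fix X :: cmat and d assume X: "X \<in> carrier_mat m m"
  note L = lin_mapD[OF assms(1)] lin_mapD[OF assms(2)]
  show "c \<cdot>\<^sub>m \<Phi> (d \<cdot>\<^sub>m X) - \<Psi> (d \<cdot>\<^sub>m X) = d \<cdot>\<^sub>m (c \<cdot>\<^sub>m \<Phi> X - \<Psi> X)"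
    using L(1,4)[OF X] unfolding L(3,6)[OF X] by (auto simp: algebra_simps)
qed (use lin_mapD(1)[OF assms(1)] lin_mapD(1)[OF assms(2)] in \<open>auto intro!: minus_carrier_mat\<close>)

lemma qf_ampl_smult_diff:
  assumes "lin_map m n \<Phi>" "lin_map m n \<Psi>"
  shows "qf (k * n) (ampl k m n (\<lambda>X. c \<cdot>\<^sub>m \<Phi> X - \<Psi> X) X) v w
    = c * qf (k * n) (ampl k m n \<Phi> X) v w - qf (k * n) (ampl k m n \<Psi> X) v w"
  unfolding qf_ampl sum_distrib_left sum_subtractf[symmetric]
proof (intro sum.cong refl)
  fix r s assume "r \<in> {..<k*n}" "s \<in> {..<k*n}"
  then have m: "r mod n < n" "s mod n < n" by (auto intro: mod_index_less)
  show "cnj (v r) * (c \<cdot>\<^sub>m \<Phi> (blk m (r div n) (s div n) X) - \<Psi> (blk m (r div n) (s div n) X)) $$ (r mod n, s mod n) * w s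
    = c * (cnj (v r) * \<Phi> (blk m (r div n) (s div n) X) $$ (r mod n, s mod n) * w s)
      - cnj (v r) * \<Psi> (blk m (r div n) (s div n) X) $$ (r mod n, s mod n) * w s"
    using m lin_mapD(1)[OF assms(1) blk_carrier, of "r div n" "s div n" X]
      lin_mapD(1)[OF assms(2) blk_carrier, of "r div n" "s div n" X]
    by (simp add: algebra_simps)
qed

section \<open>A Cauchy-Schwarz estimate and domination of the identity\<close>

lemma qf_diff:
  "qf n A (\<lambda>i. v i - w i) (\<lambda>i. v i - w i) = qf n A v v - qf n A v w - qf n A w v + qf n A w w"
  by (simp add: qf_def algebra_simps sum.distrib sum_subtractf)

lemma qf_sum_left: "qf n A (\<lambda>i. \<Sum>c\<in>S. v c i) w = (\<Sum>c\<in>S. qf n A (v c) w)"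
  by (induction S rule: infinite_finite_induct) (simp_all add: qf_def algebra_simps sum.distrib)

lemma qf_sum_right: "qf n A w (\<lambda>i. \<Sum>c\<in>S. v c i) = (\<Sum>c\<in>S. qf n A w (v c))"
  by (induction S rule: infinite_finite_induct) (simp_all add: qf_def algebra_simps sum.distrib)

text \<open>Cauchy-Schwarz for a positive form: twice the difference is the sum, over all pairs
  (c,e), of the values at w_c - w_e.\<close>

lemma psd_qf_sum_le:
  assumes "psd n A" "finite S"
  shows "of_nat (card S) * (\<Sum>c\<in>S. qf n A (w c) (w c))
    - qf n A (\<lambda>i. \<Sum>c\<in>S. w c i) (\<lambda>i. \<Sum>c\<in>S. w c i) \<in> \<real>\<^sub>\<ge>\<^sub>0" (is "?z \<in> _")
proof -
  have "(\<Sum>c\<in>S. \<Sum>e\<in>S. qf n A (\<lambda>i. w c i - w e i) (\<lambda>i. w c i - w e i))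
     = (\<Sum>c\<in>S. \<Sum>e\<in>S. qf n A (w c) (w c)) + (\<Sum>c\<in>S. \<Sum>e\<in>S. qf n A (w e) (w e))
      - (\<Sum>c\<in>S. \<Sum>e\<in>S. qf n A (w c) (w e)) - (\<Sum>c\<in>S. \<Sum>e\<in>S. qf n A (w e) (w c))"
    by (simp only: qf_diff sum.distrib sum_subtractf) (simp add: algebra_simps)
  also have "(\<Sum>c\<in>S. \<Sum>e\<in>S. qf n A (w e) (w c)) = (\<Sum>c\<in>S. \<Sum>e\<in>S. qf n A (w c) (w e))"
    by (rule sum.swap)
  finally have "2 * ?z = (\<Sum>c\<in>S. \<Sum>e\<in>S. qf n A (\<lambda>i. w c i - w e i) (\<lambda>i. w c i - w e i))"
    by (simp add: qf_sum_left qf_sum_right sum_distrib_left sum_negf)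
  also have "\<dots> \<in> \<real>\<^sub>\<ge>\<^sub>0"
    by (intro sum_nonneg_Reals psdD[OF assms(1)])
  finally show ?thesis by (simp add: complex_nonneg_Reals_iff)
qed

text \<open>The map d R has the Kraus operators |c><e|, because the sum of |c><e| X |e><c| over c
  and e is Tr[X] I. The vector \<open>w c e\<close> is (I (x) |e><c|) v.\<close>

lemma qf_ampl_repl:
  fixes v :: "nat \<Rightarrow> complex" and d :: nat
  defines "w \<equiv> \<lambda>c e r. if r mod d = e then v (r div d * d + c) else 0"
  shows "of_nat d * qf (k * d) (ampl k d d (repl d) X) v v = (\<Sum>c<d. \<Sum>e<d. qf (k * d) X (w c e) (w c e))"
proof -
  have "qf (k * d) X (w c e) (w c e)
      = (\<Sum>p<k. \<Sum>q<k. cnj (v (p * d + c)) * X $$ (p * d + e, q * d + e) * v (q * d + c))"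
    if e: "e < d" for c e
    unfolding qf_pair
  proof (rule sum.cong[OF refl])
    fix p
    let ?g = "\<lambda>i. \<Sum>q<k. \<Sum>j<d. cnj (w c e (p * d + i)) * X $$ (p * d + i, q * d + j) * w c e (q * d + j)"
    have "sum ?g {..<d} = sum ?g {e}"
      using e by (intro sum.mono_neutral_right) (auto simp: w_def)
    also have "\<dots> = ?g e" by simp
    also have "\<dots> = (\<Sum>q<k. cnj (v (p * d + c)) * X $$ (p * d + e, q * d + e) * v (q * d + c))"
    proof (rule sum.cong[OF refl])
      fix q
      let ?h = "\<lambda>j. cnj (w c e (p * d + e)) * X $$ (p * d + e, q * d + j) * w c e (q * d + j)"
      have "sum ?h {..<d} = sum ?h {e}"
        using e by (intro sum.mono_neutral_right) (auto simp: w_def)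
      also have "\<dots> = cnj (v (p * d + c)) * X $$ (p * d + e, q * d + e) * v (q * d + c)"
        using e by (simp add: w_def)
      finally show "sum ?h {..<d} = cnj (v (p * d + c)) * X $$ (p * d + e, q * d + e) * v (q * d + c)" .
    qed
    finally show "sum ?g {..<d} = (\<Sum>q<k. cnj (v (p * d + c)) * X $$ (p * d + e, q * d + e) * v (q * d + c))" .
  qed
  then have "(\<Sum>c<d. \<Sum>e<d. qf (k * d) X (w c e) (w c e))
     = (\<Sum>c<d. \<Sum>e<d. \<Sum>p<k. \<Sum>q<k. cnj (v (p * d + c)) * X $$ (p * d + e, q * d + e) * v (q * d + c))"
    by simp
  also have "\<dots> = (\<Sum>c<d. \<Sum>p<k. \<Sum>q<k. \<Sum>e<d. cnj (v (p * d + c)) * X $$ (p * d + e, q * d + e) * v (q * d + c))"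
    by (simp only: sum.swap[of _ "{..<k}" "{..<d}"])
  also have "\<dots> = (\<Sum>p<k. \<Sum>c<d. \<Sum>q<k. \<Sum>e<d. cnj (v (p * d + c)) * X $$ (p * d + e, q * d + e) * v (q * d + c))"
    by (rule sum.swap)
  also have "\<dots> = (\<Sum>p<k. \<Sum>c<d. \<Sum>q<k. \<Sum>y<d.
      of_nat d * (cnj (v (p * d + c)) * repl d (blk d p q X) $$ (c, y) * v (q * d + y)))"
  proof (rule sum.cong[OF refl], rule sum.cong[OF refl], rule sum.cong[OF refl])
    fix p c q assume "c \<in> {..<d}"
    then have c: "c < d" by simp
    have "(\<Sum>y<d. of_nat d * (cnj (v (p * d + c)) * repl d (blk d p q X) $$ (c, y) * v (q * d + y)))
       = (\<Sum>y<d. if y = c then cnj (v (p * d + c)) * tr (blk d p q X) * v (q * d + c) else 0)"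
      using c by (intro sum.cong refl) (auto simp: index_repl)
    also have "\<dots> = (\<Sum>e<d. cnj (v (p * d + c)) * X $$ (p * d + e, q * d + e) * v (q * d + c))"
      using c by (simp add: tr_def blk_def sum_distrib_left sum_distrib_right)
    finally show "(\<Sum>e<d. cnj (v (p * d + c)) * X $$ (p * d + e, q * d + e) * v (q * d + c)) =
      (\<Sum>y<d. of_nat d * (cnj (v (p * d + c)) * repl d (blk d p q X) $$ (c, y) * v (q * d + y)))" by simp
  qed
  also have "\<dots> = of_nat d * qf (k * d) (ampl k d d (repl d) X) v v"
    unfolding qf_pair sum_distrib_left
    by (intro sum.cong refl) (simp add: ampl_def pair_index_less)
  finally show ?thesis by simp
qed

lemma lin_map_id: "lin_map n n (\<lambda>X. X)"
  by (simp add: lin_map_def)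

text \<open>A vector \<open>v\<close> on the composite system is the sum of its \<open>d\<close> components \<open>w c c\<close>; convexity costs a
  factor \<open>d\<close>, and the \<open>w c c\<close> are the diagonal ones among the \<open>w c e\<close> that make up \<open>d \<cdot> repl\<close>.\<close>

lemma CP_repl_minus_id: "CP d d (\<lambda>X. of_real (real (d * d)) \<cdot>\<^sub>m repl d X - X)"
proof (rule CP_I)
  show "lin_map d d (\<lambda>X. of_real (real (d * d)) \<cdot>\<^sub>m repl d X - X)"
    by (rule lin_map_smult_diff[OF CP_lin_map[OF CP_repl] lin_map_id])
  fix k :: nat and X :: cmat and v :: "nat \<Rightarrow> complex" assume k: "k \<ge> 1" "psd (k * d) X"
  let ?w = "\<lambda>c e r. if r mod d = e then v (r div d * d + c) else 0"
  have id: "ampl k d d (\<lambda>Y. Y) X = X"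
    using psd_carrier[OF k(2)]
    by (intro eq_matI) (auto simp: ampl_def blk_def mod_index_less div_index_less)
  have v: "qf (k * d) X v v = qf (k * d) X (\<lambda>r. \<Sum>c<d. ?w c c r) (\<lambda>r. \<Sum>c<d. ?w c c r)"
  proof -
    have "v r = (\<Sum>c<d. ?w c c r)" if "r < k * d" for r
      using mod_index_less[OF that] by simp
    then show ?thesis unfolding qf_def by simp
  qed
  have rearrange: "a * (x + y) - z = a * y + (a * x - z)" for a x y z :: complex
    by (simp add: algebra_simps)
  let ?D = "\<Sum>c<d. qf (k * d) X (?w c c) (?w c c)"
  let ?O = "\<Sum>c<d. \<Sum>e\<in>{..<d} - {c}. qf (k * d) X (?w c e) (?w c e)"
  have split: "(\<Sum>c<d. \<Sum>e<d. qf (k * d) X (?w c e) (?w c e)) = ?D + ?O"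
    unfolding sum.distrib[symmetric]
  proof (rule sum.cong[OF refl])
    fix c assume "c \<in> {..<d}"
    then show "(\<Sum>e<d. qf (k * d) X (?w c e) (?w c e))
      = qf (k * d) X (?w c c) (?w c c) + (\<Sum>e\<in>{..<d} - {c}. qf (k * d) X (?w c e) (?w c e))"
      by (intro sum.remove) auto
  qed
  have "of_real (real (d * d)) * qf (k * d) (ampl k d d (repl d) X) v v - qf (k * d) X v v
    = of_nat d * (of_nat d * qf (k * d) (ampl k d d (repl d) X) v v) - qf (k * d) X v v" by simp
  also have "\<dots> = of_nat d * (?D + ?O) - qf (k * d) X v v"
    by (simp only: qf_ampl_repl split)
  also have "\<dots> = of_nat d * ?O + (of_nat (card {..<d}) * ?D - qf (k * d) X v v)"
    unfolding card_lessThan by (rule rearrange)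
  finally have e: "of_real (real (d * d)) * qf (k * d) (ampl k d d (repl d) X) v v - qf (k * d) X v v
    = of_nat d * ?O + (of_nat (card {..<d}) * ?D - qf (k * d) X v v)" .
  have "of_nat (card {..<d}) * ?D - qf (k * d) X v v \<in> \<real>\<^sub>\<ge>\<^sub>0"
    using psd_qf_sum_le[OF k(2) finite_lessThan, of d "\<lambda>c. ?w c c"] by (simp only: v)
  moreover have "of_nat d * ?O \<in> \<real>\<^sub>\<ge>\<^sub>0"
    by (intro nonneg_Reals_mult_I nonneg_Reals_of_nat_I sum_nonneg_Reals psdD[OF k(2)])
  ultimately show "qf (k * d) (ampl k d d (\<lambda>X. of_real (real (d * d)) \<cdot>\<^sub>m repl d X - X) X) v v \<in> \<real>\<^sub>\<ge>\<^sub>0"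
    unfolding qf_ampl_smult_diff[OF CP_lin_map[OF CP_repl] lin_map_id] id e by (intro nonneg_Reals_add_I)
qed

lemma is_channelD:
  assumes "is_channel dA dB \<Phi>"
  shows "dA \<ge> 1" "dB \<ge> 1" "CP dA dB \<Phi>" "lin_map dA dB \<Phi>"
    and "X \<in> carrier_mat dA dA \<Longrightarrow> tr (\<Phi> X) = tr X"
    and "X \<in> carrier_mat dA dA \<Longrightarrow> \<Phi> X \<in> carrier_mat dB dB"
  using assms by (auto simp: is_channel_def TP_def CP_def lin_map_def)

text \<open>Composing the bound for the identity with Phi suffices, as R after Phi is again R by
  trace preservation. This supplies a feasible t for the minimum in \<open>Hmin\<close>.\<close>

lemma CP_repl_minus_channel:
  assumes "is_channel dA dB \<Phi>"
  shows "CP dA dB (\<lambda>X. of_real (real (dB * dB)) \<cdot>\<^sub>m repl dB X - \<Phi> X)"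
  by (rule CP_cong[OF CP_comp[OF is_channelD(3)[OF assms] CP_repl_minus_id]])
    (simp add: repl_def is_channelD(5)[OF assms])

section \<open>The least dominating constant\<close>

lemma qf_unit:
  assumes "b < n"
  shows "qf n A (\<lambda>i. if i = b then 1 else 0) (\<lambda>i. if i = b then 1 else 0) = A $$ (b,b)"
proof -
  have "qf n A (\<lambda>i. if i = b then 1 else 0) (\<lambda>i. if i = b then 1 else 0)
    = (\<Sum>i<n. if i = b then \<Sum>j<n. if j = b then A $$ (i,j) else 0 else 0)"
    unfolding qf_def
  proof (rule sum.cong[OF refl])
    fix i
    show "(\<Sum>j<n. cnj (if i = b then 1 else 0) * A $$ (i,j) * (if j = b then 1 else 0))
      = (if i = b then \<Sum>j<n. if j = b then A $$ (i,j) else 0 else 0)"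
    proof (cases "i = b")
      case True
      have "(\<Sum>j<n. cnj (if i = b then 1 else 0) * A $$ (i,j) * (if j = b then 1 else 0))
        = (\<Sum>j<n. if j = b then A $$ (i,j) else 0)"
        using True by (intro sum.cong refl) simp
      with True show ?thesis by simp
    qed simp
  qed
  with assms show ?thesis by simp
qed

lemma psd_munit: "psd m (munit m a a)"
proof -
  have "qf m (munit m a a) v v = (if a < m then cnj (v a) * v a else 0)" for v
  proof -
    have "qf m (munit m a a) v v = (\<Sum>i<m. if i = a then \<Sum>j<m. if j = a then cnj (v i) * v j else 0 else 0)"
      unfolding qf_def
    proof (rule sum.cong[OF refl])
      fix i assume i: "i \<in> {..<m}"
      show "(\<Sum>j<m. cnj (v i) * munit m a a $$ (i,j) * v j) = (if i = a then \<Sum>j<m. if j = a then cnj (v i) * v j else 0 else 0)"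
      proof (cases "i = a")
        case True
        have "(\<Sum>j<m. cnj (v i) * munit m a a $$ (i,j) * v j) = (\<Sum>j<m. if j = a then cnj (v i) * v j else 0)"
          using True i by (intro sum.cong refl) (simp add: munit_def)
        with True show ?thesis by simp
      qed (use i in \<open>simp add: munit_def\<close>)
    qed
    then show ?thesis by simp
  qed
  then show ?thesis
    by (simp add: psd_iff_qf munit_def complex_nonneg_Reals_iff)
qed

text \<open>With a one-dimensional ancilla the amplification is G itself, so G maps the matrix unit
  to a positive matrix, whose diagonal entries are values of its form at unit vectors.\<close>

lemma CP_tr_nonneg:
  assumes "CP m n G"
  shows "tr (G (munit m a a)) \<in> \<real>\<^sub>\<ge>\<^sub>0"
proof -
  let ?X = "munit m a a" and ?e = "\<lambda>b i. if i = b then 1 else 0"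
  have X: "?X \<in> carrier_mat m m" by (simp add: munit_def)
  note GX = lin_mapD(1)[OF CP_lin_map[OF assms] X]
  have "blk m 0 0 ?X = ?X" using X by (intro eq_matI) (auto simp: blk_def)
  then have amp: "ampl 1 m n G ?X = G ?X"
    using GX by (intro eq_matI) (auto simp: ampl_def)
  have "tr (G ?X) = (\<Sum>b<n. qf n (G ?X) (?e b) (?e b))"
    using GX by (simp add: tr_def qf_unit)
  also have "\<dots> \<in> \<real>\<^sub>\<ge>\<^sub>0"
    using CP_D[OF assms, of 1 ?X] psd_munit[of m a] amp by (intro sum_nonneg_Reals) simp
  finally show ?thesis .
qed

lemma tr_munit: "a < m \<Longrightarrow> tr (munit m a a) = 1"
  by (simp add: tr_def munit_def)

text \<open>At the basis state |0><0| the trace of t R - Phi is t - 1. Besides the bound, this makes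
  t positive, so that |B| / t and its logarithm behave as expected.\<close>

lemma CP_dominated_ge_1:
  assumes ch: "is_channel dA dB \<Phi>" and cp: "CP dA dB (\<lambda>X. of_real t \<cdot>\<^sub>m repl dB X - \<Phi> X)"
  shows "t \<ge> 1"
proof -
  note C = is_channelD[OF ch]
  have X: "munit dA 0 0 \<in> carrier_mat dA dA" by (simp add: munit_def)
  have "tr (of_real t \<cdot>\<^sub>m repl dB (munit dA 0 0) - \<Phi> (munit dA 0 0)) = of_real (t - 1)"
    using C tr_minus[OF smult_carrier_mat[OF repl_carrier] C(6)[OF X]] tr_smult[OF repl_carrier] X
    by (simp add: tr_repl tr_munit)
  with CP_tr_nonneg[OF cp, of 0] have "(of_real (t - 1) :: complex) \<in> \<real>\<^sub>\<ge>\<^sub>0" by simp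
  then show ?thesis unfolding nonneg_Reals_of_real_iff by simp
qed

text \<open>\<open>LEAST\<close> on the reals is meaningful only if the minimum is attained. Each
  positivity condition is the preimage of a closed set under a function affine in t, so the feasible
  set is closed; it is nonempty and bounded below by 0, hence contains its infimum.\<close>

lemma least_dominating_exists:
  assumes ch: "is_channel dA dB \<Phi>"
  obtains t :: real where "t \<ge> 0" "CP dA dB (\<lambda>X. of_real t \<cdot>\<^sub>m repl dB X - \<Phi> X)"
    "\<And>s::real. s \<ge> 0 \<Longrightarrow> CP dA dB (\<lambda>X. of_real s \<cdot>\<^sub>m repl dB X - \<Phi> X) \<Longrightarrow> t \<le> s"
proof -
  let ?T = "{t::real. t \<ge> 0 \<and> CP dA dB (\<lambda>X. of_real t \<cdot>\<^sub>m repl dB X - \<Phi> X)}"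
  let ?f = "\<lambda>k X v t. of_real t * qf (k * dB) (ampl k dA dB (repl dB) X) v v - qf (k * dB) (ampl k dA dB \<Phi> X) v v"
  note l = CP_lin_map[OF CP_repl] is_channelD(4)[OF ch]
  have CP_iff: "CP dA dB (\<lambda>X. of_real t \<cdot>\<^sub>m repl dB X - \<Phi> X)
      \<longleftrightarrow> (\<forall>k\<ge>1. \<forall>X. psd (k * dA) X \<longrightarrow> (\<forall>v. ?f k X v t \<in> \<real>\<^sub>\<ge>\<^sub>0))" for t :: real
    by (simp add: CP_iff_ampl psd_iff_qf[of "_ * dB"] lin_map_smult_diff[OF l] qf_ampl_smult_diff[OF l])
  have "?T = {0..} \<inter> (\<Inter>k\<in>{1..}. \<Inter>X\<in>{X. psd (k * dA) X}. \<Inter>v. ?f k X v -` \<real>\<^sub>\<ge>\<^sub>0)"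
    unfolding CP_iff by blast
  moreover have "closed (?f k X v -` \<real>\<^sub>\<ge>\<^sub>0)" for k X v
    by (intro continuous_closed_vimage closed_nonneg_Reals_complex continuous_intros)
  ultimately have "closed ?T"
    by (simp only:) (intro closed_Int closed_INT ballI closed_atLeast)
  moreover have "?T \<noteq> {}" using CP_repl_minus_channel[OF ch] of_nat_0_le_iff by blast
  moreover have b: "bdd_below ?T" by (rule bdd_belowI[of _ 0]) auto
  ultimately have "Inf ?T \<in> ?T" by (intro closed_contains_Inf)
  then show thesis using cInf_lower[OF _ b] by (intro that[of "Inf ?T"]) auto
qed

subsection \<open>Mixing superchannels with one-dimensional source input\<close>

lemma index_mult_mat_sum:
  assumes "A \<in> carrier_mat m n" "B \<in> carrier_mat n k" "i < m" "j < k"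
  shows "(A * B) $$ (i,j) = (\<Sum>l<n. A $$ (i,l) * B $$ (l,j))"
  using assms by (simp add: scalar_prod_def lessThan_atLeast0)

text \<open>If n < a, padding V and its adjoint with zeros gives a x a matrices A and B with B A =
  1. For square matrices this forces A B = 1, yet row n of A is zero.\<close>

lemma isometry_dim_le:
  assumes "isometry a n V"
  shows "a \<le> n"
proof (rule ccontr)
  assume "\<not> a \<le> n"
  then have na: "n < a" by simp
  have V: "V \<in> carrier_mat n a" "adj V * V = 1\<^sub>m a" using assms by (auto simp: isometry_def)
  define A where "A = mat a a (\<lambda>(i,j). if i < n then V $$ (i,j) else 0)"
  define B where "B = mat a a (\<lambda>(i,j). if j < n then cnj (V $$ (j,i)) else 0)"
  have adjV: "adj V \<in> carrier_mat a n" using V by (simp add: adj_def)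
  have AB: "A \<in> carrier_mat a a" "B \<in> carrier_mat a a" by (simp_all add: A_def B_def)
  have "B * A = adj V * V"
  proof (intro eq_matI)
    fix i j assume "i < dim_row (adj V * V)" "j < dim_col (adj V * V)"
    then have ij: "i < a" "j < a" using V by (auto simp: adj_def)
    have "(B * A) $$ (i,j) = (\<Sum>l<a. if l < n then cnj (V $$ (l,i)) * V $$ (l,j) else 0)"
      unfolding index_mult_mat_sum[OF AB(2,1) ij]
      using ij by (intro sum.cong refl) (simp add: A_def B_def)
    also have "\<dots> = (\<Sum>l<n. if l < n then cnj (V $$ (l,i)) * V $$ (l,j) else 0)"
      using na by (intro sum.mono_neutral_right) auto
    also have "\<dots> = (adj V * V) $$ (i,j)"
      unfolding index_mult_mat_sum[OF adjV V(1) ij]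
      using ij V(1) by (intro sum.cong refl) (simp add: adj_def)
    finally show "(B * A) $$ (i,j) = (adj V * V) $$ (i,j)" .
  qed (use V AB in \<open>auto simp: adj_def\<close>)
  then have "A * B = 1\<^sub>m a" using mat_mult_left_right_inverse[OF AB(2,1)] V(2) by simp
  then have "(A * B) $$ (n,n) = 1" using na by simp
  moreover have "(A * B) $$ (n,n) = 0"
    using na by (simp add: A_def B_def scalar_prod_def)
  ultimately show False by simp
qed

lemma adj_one: "adj (1\<^sub>m n) = 1\<^sub>m n"
  by (intro eq_matI) (auto simp: adj_def)

lemma isometry_one: "isometry n n (1\<^sub>m n)"
  by (simp add: isometry_def adj_one)

lemma iso_ch_one: "X \<in> carrier_mat n n \<Longrightarrow> iso_ch (1\<^sub>m n) X = X"
  by (simp add: iso_ch_def adj_one)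

text \<open>A map with one-dimensional input is multiplication of a fixed matrix by a scalar, so
  tensoring it with an identity appends that matrix.\<close>

lemma ampl_from_scalar:
  assumes F: "\<And>Y. Y \<in> carrier_mat 1 1 \<Longrightarrow> F Y = Y $$ (0,0) \<cdot>\<^sub>m \<beta>"
    and \<beta>: "\<beta> \<in> carrier_mat D D" and X: "X \<in> carrier_mat a a"
  shows "tensor_map a 1 a D (\<lambda>Y. Y) F X = kron X \<beta>"
proof -
  have l: "lin_map 1 D F"
    unfolding lin_map_def using \<beta> by (auto simp: F algebra_simps)
  show ?thesis
    unfolding tensor_map_id_left[OF l]
    using X \<beta> by (intro eq_matI) (auto simp: ampl_def kron_def F blk_def mod_index_less div_index_less)
qed

text \<open>For a one-dimensional input every realization needs \<open>|R| \<ge> |A'|\<close>, so the one with \<open>R = A'\<close>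
  is automatically minimal and only the condition on \<open>E\<close> remains to be checked.\<close>

lemma mixing_from_scalar:
  assumes E: "is_channel (a * D) D E"
    and mix: "\<And>\<tau>. density a \<tau> \<Longrightarrow> E (kron \<tau> (umix D)) = umix D"
  shows "super_real 1 D a a (1\<^sub>m a) E" "mixing 1 D a a (1\<^sub>m a) E"
proof -
  show r: "super_real 1 D a a (1\<^sub>m a) E"
    using E isometry_one[of a] is_channelD(1)[OF E] by (auto simp: super_real_def)
  have "same_super 1 D a a (1\<^sub>m a) E a (1\<^sub>m a) E"
    by (simp add: same_super_def ch_eq_def)
  moreover have "a \<le> n" if "super_real 1 D a n V F" for n V F
    using that isometry_dim_le[of a n V] by (auto simp: super_real_def)
  ultimately show "mixing 1 D a a (1\<^sub>m a) E"
    unfolding mixing_def using r mix by blast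
qed

text \<open>The embedding of C^k onto the span of the first k basis vectors of C^D, for k <= D. It
  keeps the embedded uniform state diagonal, so a measurement in the computational basis recognizes
  its support.\<close>

definition trunc_id :: "nat \<Rightarrow> nat \<Rightarrow> cmat" where
  "trunc_id D k = mat D k (\<lambda>(i,j). if i = j then 1 else 0)"

lemma trunc_id_carrier: "trunc_id D k \<in> carrier_mat D k"
  and adj_trunc_id_carrier: "adj (trunc_id D k) \<in> carrier_mat k D"
  by (simp_all add: trunc_id_def adj_def)

lemma isometry_trunc_id:
  assumes "k \<le> D"
  shows "isometry k D (trunc_id D k)"
proof -
  have "adj (trunc_id D k) * trunc_id D k = 1\<^sub>m k"
  proof (intro eq_matI)
    fix i j assume "i < dim_row (1\<^sub>m k :: cmat)" "j < dim_col (1\<^sub>m k :: cmat)"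
    then have ij: "i < k" "j < k" by auto
    have "(adj (trunc_id D k) * trunc_id D k) $$ (i,j) = (\<Sum>l<D. if l = i then if i = j then 1 else 0 else 0)"
      unfolding index_mult_mat_sum[OF adj_trunc_id_carrier trunc_id_carrier ij]
      using ij by (intro sum.cong refl) (auto simp: adj_def trunc_id_def)
    then show "(adj (trunc_id D k) * trunc_id D k) $$ (i,j) = 1\<^sub>m k $$ (i,j)"
      using ij assms by simp
  qed (auto simp: adj_def trunc_id_def)
  then show ?thesis by (simp add: isometry_def trunc_id_def)
qed

lemma iso_ch_trunc_id:
  assumes "X \<in> carrier_mat k k" "k \<le> D"
  shows "iso_ch (trunc_id D k) X = mat D D (\<lambda>(i,j). if i < k \<and> j < k then X $$ (i,j) else 0)"
proof -
  have 1: "trunc_id D k * X = mat D k (\<lambda>(i,j). if i < k then X $$ (i,j) else 0)"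
  proof (intro eq_matI)
    fix i j
    assume "i < dim_row (mat D k (\<lambda>(i,j). if i < k then X $$ (i,j) else 0))"
      "j < dim_col (mat D k (\<lambda>(i,j). if i < k then X $$ (i,j) else 0))"
    then have ij: "i < D" "j < k" by auto
    have "(trunc_id D k * X) $$ (i,j) = (\<Sum>l<k. if l = i then X $$ (l,j) else 0)"
      unfolding index_mult_mat_sum[OF trunc_id_carrier assms(1) ij]
      using ij by (intro sum.cong refl) (simp add: trunc_id_def)
    then show "(trunc_id D k * X) $$ (i,j) = mat D k (\<lambda>(i,j). if i < k then X $$ (i,j) else 0) $$ (i,j)"
      using ij by simp
  qed (use assms in \<open>auto simp: trunc_id_def\<close>)
  show ?thesis
    unfolding iso_ch_def 1
  proof (intro eq_matI)
    fix i j
    assume "i < dim_row (mat D D (\<lambda>(i,j). if i < k \<and> j < k then X $$ (i,j) else 0))"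
      "j < dim_col (mat D D (\<lambda>(i,j). if i < k \<and> j < k then X $$ (i,j) else 0))"
    then have ij: "i < D" "j < D" by auto
    have "(mat D k (\<lambda>(i,j). if i < k then X $$ (i,j) else 0) * adj (trunc_id D k)) $$ (i,j)
      = (\<Sum>l<k. if l = j then if i < k then X $$ (i,l) else 0 else 0)"
      unfolding index_mult_mat_sum[OF mat_carrier adj_trunc_id_carrier ij]
      using ij by (intro sum.cong refl) (simp add: trunc_id_def adj_def)
    with ij show "(mat D k (\<lambda>(i,j). if i < k then X $$ (i,j) else 0) * adj (trunc_id D k)) $$ (i,j)
      = mat D D (\<lambda>(i,j). if i < k \<and> j < k then X $$ (i,j) else 0) $$ (i,j)"
      using ij by simp
  qed (auto simp: trunc_id_def adj_def)
qed

lemma tr_iso_ch_trunc_id: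
  assumes "X \<in> carrier_mat k k" "k \<le> D"
  shows "tr (iso_ch (trunc_id D k) X) = tr X"
proof -
  have "tr (iso_ch (trunc_id D k) X) = (\<Sum>i<D. if i < k then X $$ (i,i) else 0)"
    by (simp add: iso_ch_trunc_id[OF assms] tr_def)
  also have "\<dots> = (\<Sum>i<k. if i < k then X $$ (i,i) else 0)"
    using assms(2) by (intro sum.mono_neutral_right) auto
  also have "\<dots> = tr X" using assms(1) by (simp add: tr_def)
  finally show ?thesis .
qed

lemma one_smult_mat: "(1 :: complex) \<cdot>\<^sub>m A = A"
  by (intro eq_matI) auto

lemma scalar_mat_eq: "Y \<in> carrier_mat 1 1 \<Longrightarrow> Y = Y $$ (0,0) \<cdot>\<^sub>m (1\<^sub>m 1 :: cmat)"
  by (intro eq_matI) auto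

text \<open>Taking R = A' and V = 1, the superchannel turns the embedded source state beta into X
  |-> E(X (x) beta). As k <= D, \<open>maj\<close> embeds the source into the target dimension, with
  \<open>trunc_id D k\<close> as the isometry.\<close>

lemma maj_from_scalar:
  assumes \<Phi>: "lin_map 1 k \<Phi>" and k: "k \<le> D"
    and E: "is_channel (a * D) D E"
    and mix: "\<And>\<tau>. density a \<tau> \<Longrightarrow> E (kron \<tau> (umix D)) = umix D"
    and \<Psi>: "\<And>X. X \<in> carrier_mat a a \<Longrightarrow> \<Psi> X = E (kron X (iso_ch (trunc_id D k) (\<Phi> (1\<^sub>m 1))))"
  shows "maj 1 k \<Phi> a D \<Psi>"
proof -
  let ?W = "trunc_id D k" and ?\<beta> = "iso_ch (trunc_id D k) (\<Phi> (1\<^sub>m 1))"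
  have one: "(1\<^sub>m 1 :: cmat) \<in> carrier_mat 1 1" by simp
  have \<Phi>1: "\<Phi> (1\<^sub>m 1) \<in> carrier_mat k k" by (rule lin_mapD(1)[OF \<Phi> one])
  have F: "(iso_ch ?W \<circ> \<Phi>) Y = Y $$ (0,0) \<cdot>\<^sub>m ?\<beta>" if Y: "Y \<in> carrier_mat 1 1" for Y
  proof -
    have eq: "\<Phi> Y = Y $$ (0,0) \<cdot>\<^sub>m \<Phi> (1\<^sub>m 1)"
      using lin_mapD(3)[OF \<Phi> one] scalar_mat_eq[OF Y] by metis
    show ?thesis
      unfolding comp_def eq iso_ch_trunc_id[OF smult_carrier_mat[OF \<Phi>1] k] iso_ch_trunc_id[OF \<Phi>1 k]
      using \<Phi>1 by (intro eq_matI) auto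
  qed
  have \<beta>: "?\<beta> \<in> carrier_mat D D" unfolding iso_ch_trunc_id[OF \<Phi>1 k] by (rule mat_carrier)
  have "ch_eq a \<Psi> (super_apply 1 D a (1\<^sub>m a) E (iso_ch ?W \<circ> \<Phi>))"
    unfolding ch_eq_def super_apply_def
    by (intro ballI) (simp only: iso_ch_one ampl_from_scalar[OF F \<beta>] \<Psi>)
  then have "maj_same 1 D (iso_ch ?W \<circ> \<Phi>) a \<Psi>"
    unfolding maj_same_def using mixing_from_scalar[OF E mix] by blast
  then show ?thesis
    unfolding maj_def using k isometry_trunc_id[OF k] by auto
qed

lemma is_channel_repl: "m \<ge> 1 \<Longrightarrow> n \<ge> 1 \<Longrightarrow> is_channel m n (repl n)"
  by (simp add: is_channel_def CP_repl TP_def tr_repl)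

lemma tr_kron:
  assumes "A \<in> carrier_mat m m" "B \<in> carrier_mat n n"
  shows "tr (kron A B) = tr A * tr B"
proof -
  have "tr (kron A B) = (\<Sum>i<m. \<Sum>j<n. A $$ (i,i) * B $$ (j,j))"
    using assms by (simp add: tr_def kron_def sum_lessThan_mult pair_index_less)
  then show ?thesis using assms by (simp add: tr_def sum_product)
qed

lemma density_carrier: "density n \<tau> \<Longrightarrow> \<tau> \<in> carrier_mat n n"
  by (simp add: density_def psd_carrier)

text \<open>Discarding everything and preparing u_D is a mixing operation. The target is prescribed
  on 1 x 1 matrices alone, so that the lemma also compares functions that represent the same uniform
  state but may differ on other arguments.\<close>

lemma maj_uniform:
  assumes \<Phi>: "is_channel 1 k \<Phi>" and k: "k \<le> D"
    and \<Psi>: "\<And>X. X \<in> carrier_mat 1 1 \<Longrightarrow> \<Psi> X = repl D X"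
  shows "maj 1 k \<Phi> 1 D \<Psi>"
proof (rule maj_from_scalar[OF is_channelD(4)[OF \<Phi>] k])
  have D: "D \<ge> 1" using is_channelD(2)[OF \<Phi>] k by simp
  have one: "(1\<^sub>m 1 :: cmat) \<in> carrier_mat 1 1" by simp
  show "is_channel (1 * D) D (repl D)" using is_channel_repl D by simp
  show "repl D (kron \<tau> (umix D)) = umix D" if "density 1 \<tau>" for \<tau>
    using that tr_kron[OF density_carrier[OF that] umix_carrier] D
    by (simp add: repl_def tr_umix density_def one_smult_mat)
  fix X :: cmat assume X: "X \<in> carrier_mat 1 1"
  have \<Phi>1: "\<Phi> (1\<^sub>m 1) \<in> carrier_mat k k" by (rule is_channelD(6)[OF \<Phi> one])
  have c: "iso_ch (trunc_id D k) (\<Phi> (1\<^sub>m 1)) \<in> carrier_mat D D" unfolding iso_ch_trunc_id[OF \<Phi>1 k] by (rule mat_carrier)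
  have "tr (iso_ch (trunc_id D k) (\<Phi> (1\<^sub>m 1))) = tr (1\<^sub>m 1)"
    by (simp only: tr_iso_ch_trunc_id[OF \<Phi>1 k] is_channelD(5)[OF \<Phi> one])
  then have "tr (kron X (iso_ch (trunc_id D k) (\<Phi> (1\<^sub>m 1)))) = tr X"
    unfolding tr_kron[OF X c] by (simp add: tr_def)
  then show "\<Psi> X = repl D (kron X (iso_ch (trunc_id D k) (\<Phi> (1\<^sub>m 1))))"
    using \<Psi>[OF X] by (simp add: repl_def)
qed

section \<open>Measurement followed by a conditional channel\<close>

definition measure_prepare :: "nat \<Rightarrow> nat \<Rightarrow> (nat \<Rightarrow> chmap) \<Rightarrow> chmap" where
  "measure_prepare a D \<Lambda> X = mat D D (\<lambda>xy. \<Sum>b<D. \<Lambda> b (slice a D b X) $$ xy)"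

lemma slice_carrier [simp]: "slice a d b X \<in> carrier_mat a a"
  by (simp add: slice_def)

text \<open>The slices are the unnormalized states of the first factor after a computational-basis
  measurement of the second, and their traces add up to that of X. Outcomes that share the same map
  act as one projective outcome, so a test for a coordinate subspace is a special case.\<close>

lemma is_channel_measure_prepare:
  assumes \<Lambda>: "\<And>b. b < D \<Longrightarrow> is_channel a D (\<Lambda> b)" and D: "D \<ge> 1"
  shows "is_channel (a * D) D (measure_prepare a D \<Lambda>)"
proof -
  have a: "a \<ge> 1" using is_channelD(1)[OF \<Lambda>[of 0]] D by simp
  have "CP (a * D) D (\<lambda>X. mat D D (\<lambda>xy. \<Sum>b<D. \<Lambda> b (slice a D b X) $$ xy))"
    by (intro CP_sum CP_comp[OF CP_slice] is_channelD(3)[OF \<Lambda>])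
  then have "CP (a * D) D (measure_prepare a D \<Lambda>)"
    by (rule CP_cong) (simp add: measure_prepare_def)
  moreover have "tr (measure_prepare a D \<Lambda> X) = tr X" if X: "X \<in> carrier_mat (a * D) (a * D)" for X
  proof -
    have t: "(\<Sum>x<D. \<Lambda> b (slice a D b X) $$ (x,x)) = tr (slice a D b X)" if "b < D" for b
      using is_channelD(5,6)[OF \<Lambda>[OF that] slice_carrier, of D b X] by (simp add: tr_def)
    have "tr (measure_prepare a D \<Lambda> X) = (\<Sum>b<D. \<Sum>x<D. \<Lambda> b (slice a D b X) $$ (x,x))"
      by (simp add: tr_def measure_prepare_def) (rule sum.swap)
    also have "\<dots> = (\<Sum>b<D. tr (slice a D b X))" using t by simp
    also have "\<dots> = tr X"
      using X by (simp add: tr_def slice_def sum_lessThan_mult) (rule sum.swap)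
    finally show ?thesis .
  qed
  ultimately show ?thesis using a D by (simp add: is_channel_def TP_def)
qed

lemma measure_prepare_kron:
  assumes \<Lambda>: "\<And>b. b < D \<Longrightarrow> lin_map a D (\<Lambda> b)"
    and X: "X \<in> carrier_mat a a" and \<beta>: "\<beta> \<in> carrier_mat D D"
  shows "measure_prepare a D \<Lambda> (kron X \<beta>) = mat D D (\<lambda>xy. \<Sum>b<D. \<beta> $$ (b,b) * \<Lambda> b X $$ xy)"
proof (intro eq_matI)
  fix x y
  assume "x < dim_row (mat D D (\<lambda>xy. \<Sum>b<D. \<beta> $$ (b,b) * \<Lambda> b X $$ xy))"
    "y < dim_col (mat D D (\<lambda>xy. \<Sum>b<D. \<beta> $$ (b,b) * \<Lambda> b X $$ xy))"
  then have xy: "x < D" "y < D" by auto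
  have "slice a D b (kron X \<beta>) = \<beta> $$ (b,b) \<cdot>\<^sub>m X" if "b < D" for b
    using X \<beta> that by (intro eq_matI) (auto simp: slice_def kron_def pair_index_less)
  then have "\<Lambda> b (slice a D b (kron X \<beta>)) $$ (x,y) = \<beta> $$ (b,b) * \<Lambda> b X $$ (x,y)" if "b < D" for b
    using that lin_mapD(1,3)[OF \<Lambda>[OF that] X] xy by simp
  then show "measure_prepare a D \<Lambda> (kron X \<beta>) $$ (x,y) = mat D D (\<lambda>xy. \<Sum>b<D. \<beta> $$ (b,b) * \<Lambda> b X $$ xy) $$ (x,y)"
    using xy by (simp add: measure_prepare_def)
qed (auto simp: measure_prepare_def)

text \<open>The first \<open>k\<close> outcomes prepare \<open>\<Psi>\<close>; the weights \<open>k / (D - k)\<close> and \<open>D / k\<close> make the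
  remaining ones complement \<open>\<Psi>\<close> to the replacement channel, which is what mixing requires.\<close>

lemma maj_of_dominated:
  assumes \<Psi>: "is_channel a D \<Psi>" and k: "1 \<le> k" "k < D"
    and cp: "CP a D (\<lambda>X. of_real (real D / real k) \<cdot>\<^sub>m repl D X - \<Psi> X)"
  shows "maj 1 k (repl k) a D \<Psi>"
proof -
  let ?G = "\<lambda>X. of_real (real D / real k) \<cdot>\<^sub>m repl D X - \<Psi> X"
  let ?\<sigma> = "\<lambda>X. of_real (real k / real (D - k)) \<cdot>\<^sub>m ?G X"
  define \<Lambda> where "\<Lambda> b = (if b < k then \<Psi> else ?\<sigma>)" for b :: nat
  have a: "a \<ge> 1" and D: "D \<ge> 1" using is_channelD(1,2)[OF \<Psi>] .
  note \<Psi>c = is_channelD(6)[OF \<Psi>]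
  \<comment> \<open>The bracket has trace D / k - 1 = (D - k) / k times that of X, which the
    prefactor cancels; k < D keeps the denominator nonzero.\<close>
  have "tr (?\<sigma> X) = tr X" if X: "X \<in> carrier_mat a a" for X
  proof -
    have "tr (?\<sigma> X) = of_real (real k / real (D - k)) * (of_real (real D / real k) * tr X - tr X)"
      unfolding tr_smult[OF minus_carrier_mat[OF \<Psi>c[OF X]]]
        tr_minus[OF smult_carrier_mat[OF repl_carrier] \<Psi>c[OF X]] tr_smult[OF repl_carrier]
        tr_repl[OF D] is_channelD(5)[OF \<Psi> X] ..
    also have "\<dots> = of_real (real k / real (D - k) * (real D / real k - 1)) * tr X"
      by (simp only: of_real_mult of_real_diff of_real_1 left_diff_distrib right_diff_distrib
          mult_1_left mult_1_right mult.assoc)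
    also have "real k / real (D - k) * (real D / real k - 1) = 1"
      using k by (simp add: of_nat_diff field_simps)
    finally show ?thesis by simp
  qed
  then have "is_channel a D ?\<sigma>"
    unfolding is_channel_def TP_def using a D CP_smult[OF cp, of "real k / real (D - k)"] by simp
  then have \<Lambda>: "is_channel a D (\<Lambda> b)" for b using \<Psi> by (simp add: \<Lambda>_def)
  note mp = measure_prepare_kron[of D a \<Lambda>, OF is_channelD(4)[OF \<Lambda>]]
  show ?thesis
  proof (rule maj_from_scalar[OF CP_lin_map[OF CP_repl]])
    show "is_channel (a * D) D (measure_prepare a D \<Lambda>)" by (rule is_channel_measure_prepare[OF \<Lambda> D])
    show "measure_prepare a D \<Lambda> (kron \<tau> (umix D)) = umix D" if "density a \<tau>" for \<tau>
    proof -
      note \<tau> = density_carrier[OF that]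
      have t1: "tr \<tau> = 1" using that by (simp add: density_def)
      \<comment> \<open>On u_D all outcomes are equally likely, so the output is k / D times Psi
        plus (D - k) / D times the complementary channel. This average is R, and R sends every
        density matrix to u_D.\<close>
      have "(\<Sum>b<D. umix D $$ (b,b) * \<Lambda> b \<tau> $$ (x,y)) = umix D $$ (x,y)" if xy: "x < D" "y < D" for x y
      proof -
        let ?p = "\<Psi> \<tau> $$ (x,y)" and ?u = "umix D $$ (x,y)"
        define S where "S = ?\<sigma> \<tau> $$ (x,y)"
        have s: "S = of_real (real k / real (D - k)) * (of_real (real D / real k) * ?u - ?p)"
          unfolding S_def using xy \<Psi>c[OF \<tau>] t1 by (simp add: index_repl index_umix)
        have "(\<Sum>b<D. umix D $$ (b,b) * \<Lambda> b \<tau> $$ (x,y)) = (\<Sum>b<D. 1 / of_nat D * \<Lambda> b \<tau> $$ (x,y))"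
          by (intro sum.cong refl) (simp add: index_umix)
        also have "\<dots>
           = (\<Sum>b<k. 1 / of_nat D * \<Lambda> b \<tau> $$ (x,y)) + (\<Sum>b=k..<D. 1 / of_nat D * \<Lambda> b \<tau> $$ (x,y))"
          using k by (subst sum.union_disjoint[symmetric]) (auto intro: sum.cong)
        also have "\<dots> = (\<Sum>b<k. 1 / of_nat D * ?p) + (\<Sum>b=k..<D. 1 / of_nat D * S)"
          unfolding S_def by (intro arg_cong2[where f = "(+)"] sum.cong refl) (simp_all add: \<Lambda>_def)
        also have "\<dots> = of_nat k / of_nat D * ?p + of_nat (D - k) / of_nat D * S"
          by simp
        also have "\<dots> = ?u"
          unfolding s using k D by (simp add: of_nat_diff field_simps)
        finally show ?thesis .
      qed
      then show ?thesis
        unfolding mp[OF \<tau> umix_carrier] by (intro eq_matI) auto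
    qed
    fix X :: cmat assume X: "X \<in> carrier_mat a a"
    let ?\<beta> = "iso_ch (trunc_id D k) (repl k (1\<^sub>m 1))"
    have \<beta>: "?\<beta> = mat D D (\<lambda>(i,j). if i < k \<and> j < k then repl k (1\<^sub>m 1) $$ (i,j) else 0)"
      using k by (intro iso_ch_trunc_id) auto
    then have \<beta>c: "?\<beta> \<in> carrier_mat D D" by simp
    \<comment> \<open>The embedded uniform state gives weight 1 / k to each outcome b < k and none
      to the others, so the complementary channel is never triggered.\<close>
    have "(\<Sum>b<D. ?\<beta> $$ (b,b) * \<Lambda> b X $$ (x,y)) = \<Psi> X $$ (x,y)" for x y
    proof -
      have "(\<Sum>b<D. ?\<beta> $$ (b,b) * \<Lambda> b X $$ (x,y)) = (\<Sum>b<D. if b < k then 1 / of_nat k * \<Psi> X $$ (x,y) else 0)"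
        unfolding \<beta> by (intro sum.cong refl) (auto simp: \<Lambda>_def index_repl tr_def)
      also have "\<dots> = (\<Sum>b<k. if b < k then 1 / of_nat k * \<Psi> X $$ (x,y) else 0)"
        using k by (intro sum.mono_neutral_right) auto
      finally show ?thesis using k by simp
    qed
    then show "\<Psi> X = measure_prepare a D \<Lambda> (kron X ?\<beta>)"
      unfolding mp[OF X \<beta>c] using \<Psi>c[OF X] by (intro eq_matI) auto
  qed (use k in simp)
qed

section \<open>Appending a uniform state to a channel\<close>

lemma tensor_map_repl:
  assumes "lin_map m n \<Phi>" and X: "X \<in> carrier_mat m m" and l: "l \<ge> 1"
  shows "tensor_map m 1 n l \<Phi> (repl l) X = kron (\<Phi> X) (umix l)"
proof (intro eq_matI)
  note \<Phi>c = lin_mapD(1)[OF assms(1)]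
  fix r s assume "r < dim_row (kron (\<Phi> X) (umix l))" "s < dim_col (kron (\<Phi> X) (umix l))"
  then have r: "r < n * l" "s < n * l" using \<Phi>c[OF X] by (auto simp: kron_def)
  note rs = index_less(2,3)[OF r(1)] index_less(2,3)[OF r(2)]
  have mu: "munit m a b \<in> carrier_mat m m" for a b by (simp add: munit_def)
  have d: "dim_row (\<Phi> (munit m a b)) = n" "dim_col (\<Phi> (munit m a b)) = n" for a b
    using \<Phi>c[OF mu, of a b] by auto
  have u: "repl l (munit 1 0 0) = umix l" by (simp add: repl_def tr_munit one_smult_mat)
  have "tensor_map m 1 n l \<Phi> (repl l) X $$ (r,s)
    = (\<Sum>i<m. \<Sum>j<m. X $$ (i,j) * (\<Phi> (munit m i j) $$ (r div l, s div l) * umix l $$ (r mod l, s mod l)))"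
    using r rs d by (simp add: tensor_map_def kron_def u[simplified])
  also have "\<dots> = \<Phi> X $$ (r div l, s div l) * umix l $$ (r mod l, s mod l)"
    using lin_map_entries[OF assms(1) X rs(1,3)] by (simp add: sum_distrib_left sum_distrib_right mult.assoc)
  finally show "tensor_map m 1 n l \<Phi> (repl l) X $$ (r,s) = kron (\<Phi> X) (umix l) $$ (r,s)"
    using r \<Phi>c[OF X] by (simp add: kron_def)
qed (use lin_mapD(1)[OF assms(1) X] in \<open>auto simp: tensor_map_def kron_def\<close>)

lemma kron_umix: "kron (umix m) (umix n) = umix (m * n)"
proof (intro eq_matI)
  fix i j assume "i < dim_row (umix (m * n))" "j < dim_col (umix (m * n))"
  then have ij: "i < m * n" "j < m * n" by auto
  have "i div n = j div n \<and> i mod n = j mod n \<longleftrightarrow> i = j" by (metis div_mult_mod_eq)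
  then show "kron (umix m) (umix n) $$ (i,j) = umix (m * n) $$ (i,j)"
    using ij by (auto simp: kron_def index_umix div_index_less mod_index_less)
qed (auto simp: kron_def)

lemma kron_smult_left: "kron (c \<cdot>\<^sub>m A) B = c \<cdot>\<^sub>m kron A B"
  by (intro eq_matI) (auto simp: kron_def div_index_less)

lemma kron_repl_umix: "kron (repl m X) (umix n) = repl (m * n) X"
  by (simp add: repl_def kron_smult_left kron_umix)

lemma kron_diff_left:
  assumes "A \<in> carrier_mat m n" "B \<in> carrier_mat m n"
  shows "kron (A - B) C = kron A C - kron B C"
  using assms by (intro eq_matI) (auto simp: kron_def div_index_less algebra_simps)

lemma is_channel_tensor_repl:
  assumes \<Phi>: "is_channel m n \<Phi>" and l: "l \<ge> 1"
  shows "is_channel m (n * l) (tensor_map m 1 n l \<Phi> (repl l))"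
proof -
  note t = tensor_map_repl[OF is_channelD(4)[OF \<Phi>] _ l]
  have "CP m (n * l) (tensor_map m 1 n l \<Phi> (repl l))"
    by (rule CP_cong[OF CP_comp[OF is_channelD(3)[OF \<Phi>] CP_kron_umix] t])
  moreover have "tr (tensor_map m 1 n l \<Phi> (repl l) X) = tr X" if X: "X \<in> carrier_mat m m" for X
    unfolding t[OF X] tr_kron[OF is_channelD(6)[OF \<Phi> X] umix_carrier] tr_umix[OF l] is_channelD(5)[OF \<Phi> X]
    by simp
  moreover have "n * l \<ge> 1" using is_channelD(2)[OF \<Phi>] l by simp
  ultimately show ?thesis using is_channelD(1)[OF \<Phi>] by (simp add: is_channel_def TP_def)
qed

text \<open>Appending u_l to t R - Phi yields t R - Phi (x) u_l with R now onto the larger system,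
  and the excess (s - t) R is completely positive. The slack is there because s will be |B| l / k,
  which need not equal t.\<close>

lemma CP_tensor_repl_dominated:
  assumes \<Phi>: "is_channel m n \<Phi>" and l: "l \<ge> 1" and "t \<le> s"
    and cp: "CP m n (\<lambda>X. of_real t \<cdot>\<^sub>m repl n X - \<Phi> X)"
  shows "CP m (n * l) (\<lambda>X. of_real s \<cdot>\<^sub>m repl (n * l) X - tensor_map m 1 n l \<Phi> (repl l) X)"
proof -
  have "CP m (n * l) (\<lambda>X. of_real (s - t) \<cdot>\<^sub>m repl (n * l) X + kron (of_real t \<cdot>\<^sub>m repl n X - \<Phi> X) (umix l))"
    using assms(3) by (intro CP_add CP_smult[OF CP_repl] CP_comp[OF cp CP_kron_umix]) simp
  then show ?thesis
  proof (rule CP_cong)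
    fix X :: cmat assume X: "X \<in> carrier_mat m m"
    have "kron (of_real t \<cdot>\<^sub>m repl n X - \<Phi> X) (umix l)
      = of_real t \<cdot>\<^sub>m repl (n * l) X - tensor_map m 1 n l \<Phi> (repl l) X"
      using kron_diff_left[OF smult_carrier_mat[OF repl_carrier] is_channelD(6)[OF \<Phi> X]]
      unfolding tensor_map_repl[OF is_channelD(4)[OF \<Phi>] X l] by (simp add: kron_smult_left kron_repl_umix)
    moreover have "tensor_map m 1 n l \<Phi> (repl l) X \<in> carrier_mat (n * l) (n * l)"
      by (rule is_channelD(6)[OF is_channel_tensor_repl[OF \<Phi> l] X])
    ultimately show "of_real s \<cdot>\<^sub>m repl (n * l) X - tensor_map m 1 n l \<Phi> (repl l) X
      = of_real (s - t) \<cdot>\<^sub>m repl (n * l) X + kron (of_real t \<cdot>\<^sub>m repl n X - \<Phi> X) (umix l)"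
      by (intro eq_matI) (auto simp: algebra_simps)
  qed
qed

subsection \<open>Entropies\<close>

text \<open>Sandwiching \<open>l ^ n\<close> between consecutive powers of two pins \<open>n f(l)\<close> to within \<open>1\<close> of
  \<open>n log l\<close> for every \<open>n\<close>.\<close>

lemma additive_mono_eq_log:
  fixes f :: "nat \<Rightarrow> real"
  assumes add: "\<And>k l. 1 \<le> k \<Longrightarrow> 1 \<le> l \<Longrightarrow> f (k * l) = f k + f l"
    and mono: "\<And>k l. 1 \<le> k \<Longrightarrow> k \<le> l \<Longrightarrow> f k \<le> f l"
    and two: "f 2 = 1" and l: "1 \<le> l"
  shows "f l = log 2 (real l)"
proof -
  have "f 1 = 0" using add[of 1 1] by simp
  then have pow: "f (k ^ n) = real n * f k" if "1 \<le> k" for k n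
  proof (induction n)
    case (Suc n)
    have "f (k ^ Suc n) = f k + f (k ^ n)" using add[of k "k ^ n"] that by simp
    with Suc show ?case by (simp add: algebra_simps)
  qed simp
  have near: "real n * \<bar>f l - log 2 (real l)\<bar> \<le> 1" for n
  proof -
    define a where "a = nat \<lfloor>log 2 (real (l ^ n))\<rfloor>"
    have ln: "1 \<le> real (l ^ n)" using l by simp
    \<comment> \<open>Since l >= 1 the floor is nonnegative and \<open>nat\<close> leaves it
      unchanged; a is thus the exponent with 2^a <= l^n < 2^(a+1).\<close>
    then have "0 \<le> log 2 (real (l ^ n))" using l by simp
    then have a: "real a \<le> log 2 (real (l ^ n))" "log 2 (real (l ^ n)) < real a + 1"
      unfolding a_def by linarith+
    have "2 ^ a \<le> real (l ^ n)"
      using a(1) l by (simp add: le_log_iff powr_realpow)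
    then have "real (2 ^ a) \<le> real (l ^ n)" by simp
    then have 1: "2 ^ a \<le> l ^ n" by (simp only: of_nat_le_iff)
    have "real (l ^ n) < 2 powr (real a + 1)"
      using a(2) l by (subst (asm) log_less_iff) auto
    also have "\<dots> = real (2 ^ (a + 1))" by (simp add: powr_add powr_realpow)
    finally have 2: "l ^ n \<le> 2 ^ (a + 1)" by linarith
    have "real a \<le> real n * f l" using mono[OF _ 1] pow[of 2 a] pow[of l n] two l by simp
    moreover have "real n * f l \<le> real a + 1"
      using mono[OF _ 2] pow[of 2 "a + 1"] pow[of l n] two l by simp
    moreover have "log 2 (real (l ^ n)) = real n * log 2 (real l)" using l by (simp add: log_nat_power)
    ultimately have "\<bar>real n * f l - real n * log 2 (real l)\<bar> \<le> 1" using a by linarith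
    then show ?thesis by (simp add: abs_mult flip: right_diff_distrib)
  qed
  show ?thesis
  proof (rule ccontr)
    assume "f l \<noteq> log 2 (real l)"
    then have "0 < \<bar>f l - log 2 (real l)\<bar>" by simp
    from reals_Archimedean3[OF this] obtain n where "1 < real n * \<bar>f l - log 2 (real l)\<bar>" by blast
    with near[of n] show False by simp
  qed
qed

lemma channel_entropyD:
  assumes "channel_entropy H"
  shows "is_channel dA dB \<Phi> \<Longrightarrow> is_channel dA' dB' \<Psi> \<Longrightarrow> maj dA dB \<Phi> dA' dB' \<Psi> \<Longrightarrow> H dA dB \<Phi> \<le> H dA' dB' \<Psi>"
    and "is_channel dA dB \<Phi> \<Longrightarrow> is_channel dA' dB' \<Psi> \<Longrightarrow>
      H (dA * dA') (dB * dB') (tensor_map dA dA' dB dB' \<Phi> \<Psi>) = H dA dB \<Phi> + H dA' dB' \<Psi>"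
    and "H 1 2 (repl 2) = 1"
  using assms unfolding channel_entropy_def by blast+

text \<open>Uniform states of growing dimension are ordered by majorization, and u_k (x) u_l is
  u_{kl}; this makes their entropies monotone and additive in the dimension.\<close>

lemma entropy_uniform:
  assumes H: "channel_entropy H" and l: "l \<ge> 1"
  shows "H 1 l (repl l) = log 2 (real l)"
proof (rule additive_mono_eq_log[where f = "\<lambda>l. H 1 l (repl l)"])
  fix k l :: nat assume kl: "1 \<le> k" "1 \<le> l"
  let ?T = "tensor_map 1 1 k l (repl k) (repl l)"
  have k: "is_channel 1 k (repl k)" and l: "is_channel 1 l (repl l)" and m: "is_channel 1 (k * l) (repl (k * l))"
    using kl by (auto intro!: is_channel_repl)
  have T: "is_channel 1 (k * l) ?T" by (rule is_channel_tensor_repl[OF k kl(2)])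
  have eq: "?T X = repl (k * l) X" if "X \<in> carrier_mat 1 1" for X
    unfolding tensor_map_repl[OF is_channelD(4)[OF k] that kl(2)] by (rule kron_repl_umix)
  \<comment> \<open>H takes a function on all matrices, while the tensor product and
    \<open>repl (k * l)\<close> are known to agree on 1 x 1 matrices. Majorization in both
    directions shows that H gives them the same value.\<close>
  have "H 1 (k * l) ?T = H 1 (k * l) (repl (k * l))"
  proof (rule antisym)
    show "H 1 (k * l) ?T \<le> H 1 (k * l) (repl (k * l))"
      by (rule channel_entropyD(1)[OF H T m maj_uniform[OF T]]) auto
    show "H 1 (k * l) (repl (k * l)) \<le> H 1 (k * l) ?T"
      by (rule channel_entropyD(1)[OF H m T maj_uniform[OF m _ eq]]) auto
  qed
  then show "H 1 (k * l) (repl (k * l)) = H 1 k (repl k) + H 1 l (repl l)"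
    using channel_entropyD(2)[OF H k l] by (simp only: mult_1_right)
next
  fix k l :: nat assume kl: "1 \<le> k" "k \<le> l"
  have k: "is_channel 1 k (repl k)" and l: "is_channel 1 l (repl l)"
    using kl by (auto intro!: is_channel_repl)
  show "H 1 k (repl k) \<le> H 1 l (repl l)"
    by (rule channel_entropyD(1)[OF H k l maj_uniform[OF k kl(2)]]) auto
qed (use channel_entropyD(3)[OF H] l in auto)

lemma entropy_ge_log_ratio:
  assumes H: "channel_entropy H" and \<Phi>: "is_channel dA dB \<Phi>"
    and cp: "CP dA dB (\<lambda>X. of_real t \<cdot>\<^sub>m repl dB X - \<Phi> X)"
    and k: "k \<ge> 1" and l: "l \<ge> 1" and kl: "real k / real l < real dB / t"
  shows "log 2 (real k) - log 2 (real l) \<le> H dA dB \<Phi>"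
proof -
  let ?T = "tensor_map dA 1 dB l \<Phi> (repl l)"
  have t: "t \<ge> 1" by (rule CP_dominated_ge_1[OF \<Phi> cp])
  \<comment> \<open>This one strict inequality serves twice: with t >= 1 it gives k < |B| l, and
    divided by k it gives the domination constant t <= |B| l / k.\<close>
  have kl': "t * real k < real dB * real l"
    using kl t l by (simp add: field_simps)
  have "real k \<le> t * real k" using t k by simp
  with kl' have "real k < real (dB * l)" by simp
  then have kD: "k < dB * l" by (simp only: of_nat_less_iff)
  have ts: "t \<le> real (dB * l) / real k" using kl' k by (simp add: field_simps)
  have T: "is_channel dA (dB * l) ?T" by (rule is_channel_tensor_repl[OF \<Phi> l])
  have ul: "is_channel 1 l (repl l)" and uk: "is_channel 1 k (repl k)"
    using k l by (auto intro!: is_channel_repl)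
  have "H 1 k (repl k) \<le> H dA (dB * l) ?T"
    by (rule channel_entropyD(1)[OF H uk T maj_of_dominated[OF T k kD CP_tensor_repl_dominated[OF \<Phi> l ts cp]]])
  also have "\<dots> = H dA dB \<Phi> + H 1 l (repl l)"
    using channel_entropyD(2)[OF H \<Phi> ul] by (simp only: mult_1_right)
  finally show ?thesis
    unfolding entropy_uniform[OF H k] entropy_uniform[OF H l] by simp
qed

theorem theorem18:
  fixes H :: "nat \<Rightarrow> nat \<Rightarrow> chmap \<Rightarrow> real" and dA dB :: nat and \<Phi> :: chmap
  assumes "channel_entropy H"
    and "is_channel dA dB \<Phi>"
  shows "H dA dB \<Phi> \<ge> Hmin dA dB \<Phi>"
proof -
  obtain t :: real where t: "t \<ge> 0" "CP dA dB (\<lambda>X. t \<cdot>\<^sub>m repl dB X - \<Phi> X)"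
    "\<And>s::real. s \<ge> 0 \<Longrightarrow> CP dA dB (\<lambda>X. s \<cdot>\<^sub>m repl dB X - \<Phi> X) \<Longrightarrow> t \<le> s"
    by (rule least_dominating_exists[OF assms(2)]) blast
  have "(LEAST t :: real. t \<ge> 0 \<and> CP dA dB (\<lambda>X. t \<cdot>\<^sub>m repl dB X - \<Phi> X)) = t"
    using t by (intro Least_equality) (auto simp: less_eq_complex_def)
  then have Hmin: "Hmin dA dB \<Phi> = log 2 (real dB / t)"
    using CP_dominated_ge_1[OF assms(2) t(2)] is_channelD(2)[OF assms(2)]
    by (simp add: Hmin_def log_divide)
  have pos: "0 < real dB / t"
    using CP_dominated_ge_1[OF assms(2) t(2)] is_channelD(2)[OF assms(2)] by simp
  show ?thesis
  proof (rule ccontr)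
    assume "\<not> ?thesis"
    then have "H dA dB \<Phi> < log 2 (real dB / t)" by (simp add: Hmin)
    then have "2 powr H dA dB \<Phi> < real dB / t" using pos by (simp add: less_log_iff)
    \<comment> \<open>Both bounds on q are strict for a reason: the upper one meets the hypothesis
      of \<open>entropy_ge_log_ratio\<close>, the lower one is what its conclusion
      contradicts.\<close>
    then obtain q where q: "q \<in> \<rat>" "2 powr H dA dB \<Phi> < q" "q < real dB / t"
      using Rats_dense_in_real by blast
    have q0: "0 < q" using q(2) by (smt (verit) powr_gt_zero)
    obtain k l :: nat where kl: "l \<noteq> 0" "\<bar>q\<bar> = real k / real l"
      using Rats_abs_nat_div_natE[OF q(1)] by blast
    have qkl: "q = real k / real l" using kl(2) q0 by simp
    have k: "k \<ge> 1" and l: "l \<ge> 1" using q0 kl(1) qkl by (auto simp: Suc_le_eq intro: gr0I)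
    have "log 2 (real k) - log 2 (real l) \<le> H dA dB \<Phi>"
      by (rule entropy_ge_log_ratio[OF assms t(2) k l]) (use q(3) qkl in simp)
    then have "log 2 q \<le> H dA dB \<Phi>" using k l by (simp add: qkl log_divide)
    then have "q \<le> 2 powr H dA dB \<Phi>" using q0 by (simp add: log_le_iff)
    with q(2) show False by simp
  qed
qed

end
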